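(* Let $X$ be a separable Banach space and let $\alpha$ be a countable ordinal with $\max(\mathrm{Sz}(X),\mathrm{Sz}(X^* ))>\omega^\alpha$. Then the metric space $(\mathcal S_\alpha,d_{1,\alpha})$ embeds bi-Lipschitzly into $X$ and into $X^*$.
   Context: Notation: subsets of $\mathbb N=\{1,2,\dots\}$ are listed increasingly. $A<B$ means $\max A<\min B$ (with $\max\emptyset=0$, $\min\emptyset=\infty$). $A\preceq B$ means $A$ is an initial segment of $B$, and $A\prec B$ means $A\preceq B$, $A\ne B$. $\mathrm{MAX}(\mathcal F)$ is the set of elements of $\mathcal F$ having no proper $\prec$-extension in $\mathcal F$. Schreier families $\mathcal S_\alpha$, $\alpha<\omega_1$: $\mathcal S_0=\{\{n\}:n\in\mathbb N\}\cup\{\emptyset\}$; $\mathcal S_{\gamma+1}=\{\emptyset\}\cup\{\bigcup_{j=1}^nE_j: n\le\min E_1,\ E_1<\dots<E_n\text{ nonempty elements of }\mathcal S_\gamma\}$; for limit $\alpha$, $\mathcal S_\alpha=\{E:\exists k\le\min E,\ E\in\mathcal S_{\lambda(\alpha,k)}\}$. Here for every countable limit ordinal $\alpha$ a sequence $(\lambda(\alpha,n))_n\subset[1,\alpha)$ increasing to $\alpha$ is fixed (recursively in $\alpha$) so that: (1) if $\alpha$ has Cantor normal form $\omega^{\xi_k}m_k+\dots+\omega^{\xi_1}m_1$ with $k\ge2$ or $m_1\ge2$, then $\lambda(\alpha,n)=\omega^{\xi_k}m_k+\dots+\omega^{\xi_1}(m_1-1)+\lambda(\omega^{\xi_1},n)$;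 (2) if $\alpha=\omega^{\omega^\kappa+\xi}$ with $1\le\xi\le\omega^\kappa$ (such $\kappa,\xi$ are unique), then $\lambda(\alpha,n)=\omega^{\omega^\kappa}\theta(n)$ for a sequence of ordinals $\theta(n)$ increasing to $\omega^\xi$ (depending on $\alpha$); (3) if $\alpha=\omega^\gamma$ is a limit ordinal, then $\mathcal S_{\lambda(\alpha,n)}\subset\mathcal S_{\lambda(\alpha,n+1)}$ for all $n$. Repeated averages: for $A\in\mathrm{MAX}(\mathcal S_\alpha)$ define $z_{(\alpha,A)}:A\to(0,1]$ recursively. $z_{(0,\{n\})}(n)=1$. Each $A\in\mathrm{MAX}(\mathcal S_{\gamma+1})$ is uniquely $A=\bigcup_{j=1}^nA_j$ with $n=\min A$ and $A_1<\dots<A_n$ in $\mathrm{MAX}(\mathcal S_\gamma)$, and $z_{(\gamma+1,A)}(a)=\frac1nz_{(\gamma,A_j)}(a)$ for $a\in A_j$. For limit $\alpha$ one has $A\in\mathrm{MAX}(\mathcal S_{\lambda(\alpha,\min A)})$ and $z_{(\alpha,A)}=z_{(\lambda(\alpha,\min A),A)}$. For nonempty $A\in\mathcal S_\alpha$ put $\zeta(\alpha,A)=z_{(\alpha,B)}(\max A)$ for any $B\in\mathrm{MAX}(\mathcal S_\alpha)$ with $A\preceq B$ (independent of $B$), and $\zeta(\alpha,\emptyset)=0$. Metric on $\mathcal S_\alpha$: with $C$ the largest common initial segment of $A$ and $B$, $d_{1,\alpha}(A,B)=\sum_{C\prec D\preceq A}\zeta(\alpha,D)+\sum_{C\prec D\preceq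 B}\zeta(\alpha,D)$. Szlenk index of a Banach space $Y$: for $K\subset Y^*$, $\varepsilon\ge0$ let $K'_\varepsilon=\{y^*\in Y^*:\exists(y_n^* )\subset K,\ w^*\text{-}\lim y_n^*=y^*,\ \|y_n^*-y^*\|>\varepsilon\text{ for all }n\}$; $K^{(0)}_\varepsilon=K$, $K^{(\alpha+1)}_\varepsilon=(K^{(\alpha)}_\varepsilon)'_\varepsilon$, $K^{(\lambda)}_\varepsilon=\bigcap_{\alpha<\lambda}K^{(\alpha)}_\varepsilon$ for limit $\lambda$. $\mathrm{Sz}(Y)=\sup_{\varepsilon>0}\sup\{\alpha<\omega_1:(B_{Y^*})^{(\alpha)}_\varepsilon\neq\emptyset\}$, where $B_{Y^*}$ is the unit ball. *)

theory Defs
  imports "HOL-Analysis.Analysis" "HOL-Library.Countable_Set_Type" "HOL-Library.Lattice_Constructions"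
begin

section \<open>Countable ordinals\<close>

text \<open>The well-order \<^term>\<open>cardSuc natLeq\<close> has order type \<open>\<omega>\<^sub>1\<close>, so the elements of the type
  below are the countable ordinals.\<close>

typedef omega1 = "Field (cardSuc natLeq)"
proof -
  include cardinal_syntax
  have "natLeq <o cardSuc natLeq"
    by (simp add: cardSuc_greater natLeq_Card_order)
  then have "infinite (Field (cardSuc natLeq))"
    by (metis Field_natLeq cardSuc_finite infinite_UNIV_nat natLeq_Card_order)
  then show ?thesis by (metis ex_in_conv finite.emptyI)
qed

lemma Well_order_omega1: "Well_order (cardSuc natLeq)"
  using cardSuc_Card_order natLeq_Card_order card_order_on_well_order_on by blast

instantiation omega1 :: linorder
begin

definition less_eq_omega1 :: "omega1 \<Rightarrow> omega1 \<Rightarrow> bool" where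
  "x \<le> y \<longleftrightarrow> (Rep_omega1 x, Rep_omega1 y) \<in> cardSuc natLeq"

definition less_omega1 :: "omega1 \<Rightarrow> omega1 \<Rightarrow> bool" where
  "x < y \<longleftrightarrow> x \<le> y \<and> \<not> y \<le> (x::omega1)"

instance
proof
  have R: "refl_on (Field (cardSuc natLeq)) (cardSuc natLeq)" "trans (cardSuc natLeq)"
      "antisym (cardSuc natLeq)" "total_on (Field (cardSuc natLeq)) (cardSuc natLeq)"
    using Well_order_omega1
    by (auto simp: well_order_on_def linear_order_on_def partial_order_on_def preorder_on_def)
  fix x y z :: omega1
  show "x < y \<longleftrightarrow> x \<le> y \<and> \<not> y \<le> x"
    by (simp add: less_omega1_def)
  show "x \<le> x"
    using R(1) Rep_omega1[of x] by (auto simp: less_eq_omega1_def refl_on_def)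
  show "x \<le> y \<Longrightarrow> y \<le> z \<Longrightarrow> x \<le> z"
    using R(2) by (auto simp: less_eq_omega1_def dest: transD)
  show "x \<le> y \<Longrightarrow> y \<le> x \<Longrightarrow> x = y"
    using R(3) by (auto simp: less_eq_omega1_def Rep_omega1_inject dest: antisymD)
  show "x \<le> y \<or> y \<le> x"
    using R(1,4) Rep_omega1[of x] Rep_omega1[of y]
    unfolding less_eq_omega1_def total_on_def refl_on_def by metis
qed

end

instance omega1 :: wellorder
proof
  fix P :: "omega1 \<Rightarrow> bool" and a
  assume step: "\<And>x. (\<And>y. y < x \<Longrightarrow> P y) \<Longrightarrow> P x"
  have wf: "wf (cardSuc natLeq - Id)"
    using Well_order_omega1 by (simp add: well_order_on_def)
  have "{(x, y :: omega1). x < y} \<subseteq> inv_image (cardSuc natLeq - Id) Rep_omega1"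
    by (auto simp: less_omega1_def less_eq_omega1_def inv_image_def Rep_omega1_inject)
  then have "wf {(x, y :: omega1). x < y}"
    using wf wf_inv_image wf_subset by blast
  then show "P a"
    by (rule wf_induct_rule) (use step in blast)
qed

lemma countable_lessThan_omega1: "countable {..<a::omega1}"
proof -
  include cardinal_syntax
  let ?r = "cardSuc natLeq"
  have co: "Card_order ?r" by (simp add: cardSuc_Card_order natLeq_Card_order)
  have "|underS ?r (Rep_omega1 a)| <o ?r"
    using card_of_underS[OF co Rep_omega1] .
  then have "|underS ?r (Rep_omega1 a)| \<le>o natLeq"
    by (simp add: cardSuc_ordLeq_ordLess natLeq_Card_order card_of_Card_order)
  then have "countable (underS ?r (Rep_omega1 a))"
    using countable_card_le_natLeq by blast
  moreover have "Rep_omega1 ` {..<a} \<subseteq> underS ?r (Rep_omega1 a)"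
    by (auto simp: underS_def less_omega1_def less_eq_omega1_def)
  ultimately have "countable (Rep_omega1 ` {..<a})"
    using countable_subset by blast
  then show ?thesis
    by (rule countable_image_inj_on) (auto simp: inj_on_def Rep_omega1_inject)
qed

lemma uncountable_omega1: "uncountable (UNIV :: omega1 set)"
proof
  include cardinal_syntax
  assume "countable (UNIV :: omega1 set)"
  then have "countable (range Rep_omega1)" by simp
  then have "countable (Field (cardSuc natLeq))"
    using type_definition.Rep_range[OF type_definition_omega1] by simp
  then have "|Field (cardSuc natLeq)| \<le>o natLeq"
    using countable_card_le_natLeq by blast
  moreover have "|Field (cardSuc natLeq)| =o cardSuc natLeq"
    by (simp add: cardSuc_Card_order card_of_Field_ordIso natLeq_Card_order)
  moreover have "natLeq <o cardSuc natLeq"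
    by (simp add: cardSuc_greater natLeq_Card_order)
  ultimately show False
    by (meson not_ordLess_ordLeq ordIso_iff_ordLeq ordLeq_transitive)
qed

lemma countable_imp_strictly_bounded_omega1:
  assumes "countable (A :: omega1 set)"
  shows "\<exists>b. \<forall>a\<in>A. a < b"
proof (rule ccontr)
  assume "\<not> ?thesis"
  then have "(UNIV :: omega1 set) \<subseteq> (\<Union>a\<in>A. insert a {..<a})"
    by (force simp: not_less le_less)
  moreover have "countable (\<Union>a\<in>A. insert a {..<a})"
    using assms countable_lessThan_omega1 by auto
  ultimately show False
    using uncountable_omega1 countable_subset by blast
qed

instantiation omega1 :: "{conditionally_complete_linorder, order_bot, zero}"
begin

definition inf_omega1 :: "omega1 \<Rightarrow> omega1 \<Rightarrow> omega1" where "inf_omega1 = min"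
definition sup_omega1 :: "omega1 \<Rightarrow> omega1 \<Rightarrow> omega1" where "sup_omega1 = max"
definition Inf_omega1 :: "omega1 set \<Rightarrow> omega1" where "Inf (A :: omega1 set) = (LEAST a. a \<in> A)"
definition Sup_omega1 :: "omega1 set \<Rightarrow> omega1" where "Sup (A :: omega1 set) = (LEAST b. \<forall>a\<in>A. a \<le> b)"
definition zero_omega1 :: omega1 where "0 = (LEAST a::omega1. True)"
definition bot_omega1 :: omega1 where "bot = (0::omega1)"

instance
proof
  fix x z :: omega1 and X :: "omega1 set"
  show "bot \<le> x"
    by (simp add: bot_omega1_def zero_omega1_def Least_le)
  show "x \<in> X \<Longrightarrow> bdd_below X \<Longrightarrow> Inf X \<le> x"
    by (simp add: Inf_omega1_def Least_le)
  show "X \<noteq> {} \<Longrightarrow> (\<And>x. x \<in> X \<Longrightarrow> z \<le> x) \<Longrightarrow> z \<le> Inf X"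
    unfolding Inf_omega1_def by (metis LeastI ex_in_conv)
  show "x \<in> X \<Longrightarrow> bdd_above X \<Longrightarrow> x \<le> Sup X"
    unfolding Sup_omega1_def bdd_above_def by (rule LeastI2_ex) auto
  show "X \<noteq> {} \<Longrightarrow> (\<And>x. x \<in> X \<Longrightarrow> x \<le> z) \<Longrightarrow> Sup X \<le> z"
    by (simp add: Sup_omega1_def Least_le)
qed (auto simp: inf_omega1_def sup_omega1_def)

end

lemma zero_le_omega1 [simp]: "0 \<le> (a::omega1)"
  using bot_least[of a] by (simp add: bot_omega1_def)

lemma not_less_zero_omega1 [simp]: "\<not> (a::omega1) < 0"
  by (simp add: not_less)

lemma zero_less_omega1_iff: "0 < (a::omega1) \<longleftrightarrow> a \<noteq> 0"
  by (metis le_less not_less_zero_omega1 zero_le_omega1)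

lemma lessThan_omega1_eq_empty_iff: "{..<a::omega1} = {} \<longleftrightarrow> a = 0"
proof
  show "{..<a} = {} \<Longrightarrow> a = 0"
    using zero_less_omega1_iff[of a] by blast
qed (auto simp: lessThan_def)

definition osuc :: "omega1 \<Rightarrow> omega1" where
  "osuc a = (LEAST b. a < b)"

definition olimit :: "omega1 \<Rightarrow> bool" where
  "olimit a \<longleftrightarrow> a \<noteq> 0 \<and> (\<forall>b. a \<noteq> osuc b)"

lemma less_osuc [simp]: "a < osuc a"
  unfolding osuc_def
  using countable_imp_strictly_bounded_omega1[of "{a}"] by (auto intro: LeastI_ex)

lemma osuc_le_iff: "osuc a \<le> b \<longleftrightarrow> a < b"
  using less_osuc[of a] by (auto simp: osuc_def Least_le)

lemma osuc_inject [simp]: "osuc a = osuc b \<longleftrightarrow> a = b"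
  by (metis less_osuc linorder_neqE not_less osuc_le_iff)

lemma osuc_neq_zero [simp]: "osuc a \<noteq> 0"
  by (metis less_osuc not_less_zero_omega1)

lemma olimit_osuc_less: "olimit a \<Longrightarrow> b < a \<Longrightarrow> osuc b < a"
  by (metis le_less olimit_def osuc_le_iff)

lemma omega1_cases [case_names zero osuc olimit]:
  obtains "a = 0" | b where "a = osuc b" | "olimit a"
  by (auto simp: olimit_def)

instantiation omega1 :: "{one, plus, times}"
begin

definition one_omega1 :: omega1 where "1 = osuc 0"

function plus_omega1 :: "omega1 \<Rightarrow> omega1 \<Rightarrow> omega1" where
  "plus_omega1 a b = (if b = 0 then a else (SUP c\<in>{..<b}. osuc (plus_omega1 a c)))"
  by auto
termination
  by (relation "inv_image {(x, y). x < y} snd") (auto intro: wf wf_inv_image)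

function times_omega1 :: "omega1 \<Rightarrow> omega1 \<Rightarrow> omega1" where
  "times_omega1 a b = (SUP c\<in>{..<b}. times_omega1 a c + a)"
  by auto
termination
  by (relation "inv_image {(x, y). x < y} snd") (auto intro: wf wf_inv_image)

instance ..

end

declare plus_omega1.simps [simp del] times_omega1.simps [simp del]

primrec nat_ord :: "nat \<Rightarrow> omega1" where
  "nat_ord 0 = 0"
| "nat_ord (Suc n) = osuc (nat_ord n)"

definition omega :: omega1 where
  "omega = (SUP n. nat_ord n)"

function omega_pow :: "omega1 \<Rightarrow> omega1" where
  "omega_pow b = (if b = 0 then 1 else (SUP c\<in>{..<b}. omega_pow c * omega))"
  by auto
termination
  by (relation "{(x, y). x < y}") (auto intro: wf)

declare omega_pow.simps [simp del]


lemma countable_imp_bdd_above_omega1: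
  "countable (A :: omega1 set) \<Longrightarrow> bdd_above A"
  using countable_imp_strictly_bounded_omega1[of A] by (auto simp: bdd_above_def intro: less_imp_le)

lemma Sup_empty_omega1: "Sup ({} :: omega1 set) = 0"
  by (simp add: Sup_omega1_def zero_omega1_def)

lemma SUP_lessThan_upper_omega1:
  fixes f :: "omega1 \<Rightarrow> omega1"
  assumes "c < b"
  shows "f c \<le> (SUP c\<in>{..<b}. f c)"
  using assms
  by (intro cSUP_upper countable_imp_bdd_above_omega1 countable_image countable_lessThan_omega1) auto

lemma SUP_osuc_omega1:
  fixes f :: "omega1 \<Rightarrow> omega1"
  assumes "\<And>c. c < b \<Longrightarrow> f c \<le> f b"
  shows "(SUP c\<in>{..<osuc b}. f c) = f b"
proof (rule antisym)
  have "f c \<le> f b" if "c < osuc b" for c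
    using that assms by (metis le_less not_less osuc_le_iff)
  then show "(SUP c\<in>{..<osuc b}. f c) \<le> f b"
    by (intro cSUP_least) (use less_osuc[of b] in \<open>auto simp del: less_osuc\<close>)
  show "f b \<le> (SUP c\<in>{..<osuc b}. f c)"
    by (rule SUP_lessThan_upper_omega1) simp
qed

lemma SUP_olimit_shift_omega1:
  fixes f g :: "omega1 \<Rightarrow> omega1"
  assumes b: "olimit b" and "\<And>c. c < b \<Longrightarrow> f c \<le> g c"
    and "\<And>c. c < b \<Longrightarrow> g c \<le> f (osuc c)"
  shows "(SUP c\<in>{..<b}. g c) = (SUP c\<in>{..<b}. f c)"
proof -
  have ne: "{..<b} \<noteq> {}"
    using b by (simp add: olimit_def lessThan_omega1_eq_empty_iff)
  show ?thesis
  proof (rule antisym)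
    show "(SUP c\<in>{..<b}. g c) \<le> (SUP c\<in>{..<b}. f c)"
      using assms(3) olimit_osuc_less[OF b] SUP_lessThan_upper_omega1[of _ b f] ne
      by (intro cSUP_least) (blast intro: order_trans)+
    show "(SUP c\<in>{..<b}. f c) \<le> (SUP c\<in>{..<b}. g c)"
      using assms(2) SUP_lessThan_upper_omega1[of _ b g] ne
      by (intro cSUP_least) (blast intro: order_trans)+
  qed
qed

lemma osuc_plus_le: "c < b \<Longrightarrow> osuc (a + c) \<le> a + (b::omega1)"
  using SUP_lessThan_upper_omega1[of c b "\<lambda>c. osuc (a + c)"]
  by (subst (2) plus_omega1.simps) auto

lemma plus_right_mono_omega1: "b \<le> c \<Longrightarrow> a + b \<le> a + (c::omega1)"
  by (metis le_less less_osuc less_le_trans osuc_plus_le)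

lemma plus_omega1_zero [simp]: "a + 0 = (a::omega1)"
  by (subst plus_omega1.simps) simp

lemma plus_omega1_osuc: "a + osuc b = osuc (a + b)"
proof -
  have "osuc (a + c) \<le> osuc (a + b)" if "c < b" for c
    using osuc_plus_le[OF that, of a] by (meson less_osuc less_imp_le order_trans)
  then show ?thesis
    by (subst plus_omega1.simps) (simp add: SUP_osuc_omega1)
qed

lemma plus_omega1_olimit:
  assumes "olimit b"
  shows "a + b = (SUP c\<in>{..<b}. a + c)"
proof -
  have "a + b = (SUP c\<in>{..<b}. osuc (a + c))"
    using assms by (subst plus_omega1.simps) (simp add: olimit_def)
  also have "\<dots> = (SUP c\<in>{..<b}. a + c)"
    using less_osuc by (intro SUP_olimit_shift_omega1[OF assms]) (auto simp: plus_omega1_osuc less_imp_le)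
  finally show ?thesis .
qed

lemma le_plus_omega1: "a \<le> a + (b::omega1)"
  using plus_right_mono_omega1[of 0 b a] by simp

lemma plus_left_mono_omega1: "a \<le> b \<Longrightarrow> a + c \<le> b + (c::omega1)"
proof (induction c rule: less_induct)
  case (less c)
  show ?case
  proof (cases "c = 0")
    case False
    have "osuc (a + d) \<le> b + c" if "d < c" for d
      using less.IH[OF that less.prems] osuc_plus_le[OF that, of b]
      by (meson le_less_trans osuc_le_iff)
    moreover have "{..<c} \<noteq> {}"
      using False by (simp add: lessThan_omega1_eq_empty_iff)
    ultimately show ?thesis
      using False by (subst plus_omega1.simps) (auto intro: cSUP_least)
  qed (use less.prems in simp)
qed

lemma times_plus_le: "c < b \<Longrightarrow> a * c + a \<le> a * (b::omega1)"
  using SUP_lessThan_upper_omega1[of c b "\<lambda>c. a * c + a"] by (subst (2) times_omega1.simps) auto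

lemma times_right_mono_omega1: "b \<le> c \<Longrightarrow> a * b \<le> a * (c::omega1)"
  by (metis le_less le_plus_omega1 order_trans times_plus_le)

lemma times_omega1_zero [simp]: "a * 0 = (0::omega1)"
proof -
  have "{..<0::omega1} = {}" by (simp add: lessThan_omega1_eq_empty_iff)
  then show ?thesis by (subst times_omega1.simps) (simp add: Sup_empty_omega1)
qed

lemma times_omega1_osuc: "a * osuc b = a * b + a"
  by (subst times_omega1.simps)
    (auto intro!: SUP_osuc_omega1 plus_left_mono_omega1 times_right_mono_omega1)

lemma times_omega1_olimit:
  assumes "olimit b"
  shows "a * b = (SUP c\<in>{..<b}. a * c)"
proof -
  have "a * b = (SUP c\<in>{..<b}. a * c + a)"
    by (subst times_omega1.simps) simp
  also have "\<dots> = (SUP c\<in>{..<b}. a * c)"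
    by (intro SUP_olimit_shift_omega1[OF assms]) (auto simp: times_omega1_osuc le_plus_omega1)
  finally show ?thesis .
qed

lemma times_left_mono_omega1: "a \<le> b \<Longrightarrow> a * c \<le> b * (c::omega1)"
proof (induction c rule: less_induct)
  case (less c)
  show ?case
  proof (cases "c = 0")
    case False
    have "a * d + a \<le> b * c" if "d < c" for d
      using less.IH[OF that less.prems] times_plus_le[OF that, of b] less.prems
      by (meson order_trans plus_left_mono_omega1 plus_right_mono_omega1)
    moreover have "{..<c} \<noteq> {}"
      using False by (simp add: lessThan_omega1_eq_empty_iff)
    ultimately show ?thesis
      by (subst times_omega1.simps) (auto intro: cSUP_least)
  qed simp
qed

lemma zero_plus_omega1 [simp]: "0 + a = (a::omega1)"
proof (rule antisym)
  show "0 + a \<le> a"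
  proof (induction a rule: less_induct)
    case (less a)
    show ?case
    proof (cases "a = 0")
      case False
      have "osuc (0 + c) \<le> a" if "c < a" for c
        using less.IH[OF that] that by (simp add: osuc_le_iff)
      moreover have "{..<a} \<noteq> {}"
        using False by (simp add: lessThan_omega1_eq_empty_iff)
      ultimately show ?thesis
        using False by (subst plus_omega1.simps) (auto intro: cSUP_least)
    qed simp
  qed
  show "a \<le> 0 + a"
  proof (induction a rule: less_induct)
    case (less a)
    show ?case
      using less osuc_plus_le[of _ a 0] by (meson le_less_trans not_less order.refl osuc_le_iff)
  qed
qed

lemma times_omega1_one [simp]: "a * 1 = (a::omega1)"
  by (simp add: one_omega1_def times_omega1_osuc)

lemma nat_ord_le_omega: "nat_ord n \<le> omega"
  unfolding omega_def
  by (intro cSUP_upper countable_imp_bdd_above_omega1) auto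

lemma olimit_omega: "olimit omega"
proof -
  have *: "nat_ord n < omega" for n
    using nat_ord_le_omega[of "Suc n"] by (simp add: osuc_le_iff)
  have "omega \<noteq> osuc b" for b
  proof
    assume b: "omega = osuc b"
    have "omega \<le> b"
      unfolding omega_def
    proof (rule cSUP_least)
      fix n
      show "nat_ord n \<le> b"
        using *[of n] b by (metis not_less osuc_le_iff)
    qed simp
    with b less_osuc[of b] show False by simp
  qed
  with *[of 0] show ?thesis by (auto simp: olimit_def)
qed

lemma omega_least_olimit: "olimit a \<Longrightarrow> omega \<le> a"
proof -
  assume a: "olimit a"
  have "nat_ord n < a" for n
    by (induction n) (use a in \<open>auto simp: olimit_def zero_less_omega1_iff intro: olimit_osuc_less[OF a]\<close>)
  then show ?thesis
    unfolding omega_def by (intro cSUP_least) (auto intro: less_imp_le)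
qed

lemma le_times_omega: "a \<le> a * omega"
  using times_right_mono_omega1[of 1 omega a] nat_ord_le_omega[of 1]
  by (simp add: one_omega1_def[symmetric])

lemma omega_pow_zero [simp]: "omega_pow 0 = 1"
  by (subst omega_pow.simps) simp

lemma omega_pow_times_le: "c < b \<Longrightarrow> omega_pow c * omega \<le> omega_pow b"
  using SUP_lessThan_upper_omega1[of c b "\<lambda>c. omega_pow c * omega"]
  by (subst (2) omega_pow.simps) auto

lemma omega_pow_mono: "b \<le> c \<Longrightarrow> omega_pow b \<le> omega_pow c"
  by (metis le_less le_times_omega order_trans omega_pow_times_le)

lemma omega_pow_osuc: "omega_pow (osuc b) = omega_pow b * omega"
  by (subst omega_pow.simps)
    (auto intro!: SUP_osuc_omega1 times_left_mono_omega1 omega_pow_mono)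

lemma omega_pow_olimit:
  assumes "olimit b"
  shows "omega_pow b = (SUP c\<in>{..<b}. omega_pow c)"
proof -
  have "omega_pow b = (SUP c\<in>{..<b}. omega_pow c * omega)"
    using assms by (subst omega_pow.simps) (simp add: olimit_def)
  also have "\<dots> = (SUP c\<in>{..<b}. omega_pow c)"
    by (intro SUP_olimit_shift_omega1[OF assms]) (auto simp: omega_pow_osuc le_times_omega)
  finally show ?thesis .
qed

text \<open>Cantor normal forms are written as lists of pairs (exponent, coefficient), with the leading
  term first.\<close>

fun cnf_sum :: "(omega1 \<times> nat) list \<Rightarrow> omega1" where
  "cnf_sum [] = 0"
| "cnf_sum ((x, m) # ps) = omega_pow x * nat_ord m + cnf_sum ps"

definition cantor_normal_form :: "(omega1 \<times> nat) list \<Rightarrow> bool" where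
  "cantor_normal_form ps \<longleftrightarrow>
     sorted_wrt (\<lambda>p q. fst q < fst p) ps \<and> (\<forall>p\<in>set ps. 1 \<le> snd p)"

text \<open>Below, \<^typ>\<open>omega1 top\<close> consists of the ordinals up to and including \<open>\<omega>\<^sub>1\<close>,
  which is the element \<^term>\<open>top.Top\<close>.\<close>

instantiation top :: ("{wellorder, conditionally_complete_linorder, order_bot}") complete_linorder
begin

definition Sup_top :: "'a top set \<Rightarrow> 'a top" where
  "Sup A = (if \<exists>b. \<forall>a\<in>A. a \<le> top.Value b
            then top.Value (LEAST b. \<forall>a\<in>A. a \<le> top.Value b) else top.Top)"

definition Inf_top :: "'a top set \<Rightarrow> 'a top" where
  "Inf A = (if \<exists>b. top.Value b \<in> A then top.Value (LEAST b. top.Value b \<in> A) else top.Top)"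

instance
proof
  fix x z :: "'a top" and A :: "'a top set"
  show 1: "x \<in> A \<Longrightarrow> x \<le> Sup A" for x and A :: "'a top set"
  proof (cases "\<exists>b. \<forall>a\<in>A. a \<le> top.Value b")
    case True
    then have "\<forall>a\<in>A. a \<le> top.Value (LEAST b. \<forall>a\<in>A. a \<le> top.Value b)"
      by (rule LeastI_ex)
    then show "x \<in> A \<Longrightarrow> ?thesis" using True by (simp add: Sup_top_def)
  qed (auto simp: Sup_top_def)
  show 2: "(\<And>x. x \<in> A \<Longrightarrow> x \<le> z) \<Longrightarrow> Sup A \<le> z" for z and A :: "'a top set"
  proof (cases z)
    case (Value b)
    assume "\<And>x. x \<in> A \<Longrightarrow> x \<le> z"
    with Value have "\<forall>a\<in>A. a \<le> top.Value b" by blast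
    with Value show ?thesis by (auto simp: Sup_top_def intro: Least_le)
  qed simp
  show 3: "x \<in> A \<Longrightarrow> Inf A \<le> x" for x and A :: "'a top set"
    by (cases x) (auto simp: Inf_top_def intro: Least_le)
  show 4: "(\<And>x. x \<in> A \<Longrightarrow> z \<le> x) \<Longrightarrow> z \<le> Inf A" for z and A :: "'a top set"
  proof (cases "\<exists>b. top.Value b \<in> A")
    case True
    then have "top.Value (LEAST b. top.Value b \<in> A) \<in> A"
      by (rule LeastI_ex)
    then show "(\<And>x. x \<in> A \<Longrightarrow> z \<le> x) \<Longrightarrow> ?thesis" using True by (simp add: Inf_top_def)
  qed (auto simp: Inf_top_def)
  have bot_le: "bot \<le> (w :: 'a top)" for w
    by (cases w) (auto simp: bot_top_def)
  show "Inf {} = (top :: 'a top)"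
    by (simp add: Inf_top_def top_top_def)
  show "Sup {} = (bot :: 'a top)"
    by (intro antisym 2 bot_le) simp
qed

end

section \<open>Schreier families and repeated averages\<close>

text \<open>For finite sets of positive integers this is \<open>max A < min B\<close> with the conventions
  \<open>max {} = 0\<close> and \<open>min {} = \<infinity>\<close>.\<close>

definition set_less :: "nat set \<Rightarrow> nat set \<Rightarrow> bool" where
  "set_less A B \<longleftrightarrow> (\<forall>a\<in>A. \<forall>b\<in>B. a < b)"

definition init_seg :: "nat set \<Rightarrow> nat set \<Rightarrow> bool" where
  "init_seg A B \<longleftrightarrow> A \<subseteq> B \<and> (\<forall>a\<in>A. \<forall>b\<in>B - A. a < b)"

definition proper_init_seg :: "nat set \<Rightarrow> nat set \<Rightarrow> bool" where
  "proper_init_seg A B \<longleftrightarrow> init_seg A B \<and> A \<noteq> B"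

definition prec_maximal :: "nat set set \<Rightarrow> nat set set" where
  "prec_maximal F = {A \<in> F. \<not> (\<exists>B\<in>F. proper_init_seg A B)}"

text \<open>The parameter \<open>l\<close> is the choice of the sequences \<open>\<lambda>(\<alpha>, n)\<close>, of which only the values for
  limit \<open>\<alpha>\<close> and \<open>n \<ge> 1\<close> are relevant.\<close>

inductive schreier_mem :: "(omega1 \<Rightarrow> nat \<Rightarrow> omega1) \<Rightarrow> omega1 \<Rightarrow> nat set \<Rightarrow> bool"
  for l :: "omega1 \<Rightarrow> nat \<Rightarrow> omega1" where
  zero_empty: "schreier_mem l 0 {}"
| zero_singleton: "1 \<le> n \<Longrightarrow> schreier_mem l 0 {n}"
| osuc_empty: "schreier_mem l (osuc g) {}"
| osuc_Union: "Es \<noteq> [] \<Longrightarrow> \<forall>E\<in>set Es. E \<noteq> {} \<and> schreier_mem l g E \<Longrightarrow>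
    sorted_wrt set_less Es \<Longrightarrow> length Es \<le> Min (hd Es) \<Longrightarrow>
    schreier_mem l (osuc g) (\<Union>(set Es))"
| olimit: "olimit a \<Longrightarrow> 1 \<le> k \<Longrightarrow> \<forall>e\<in>E. k \<le> e \<Longrightarrow> schreier_mem l (l a k) E \<Longrightarrow>
    schreier_mem l a E"

definition schreier :: "(omega1 \<Rightarrow> nat \<Rightarrow> omega1) \<Rightarrow> omega1 \<Rightarrow> nat set set" where
  "schreier l a = {E. schreier_mem l a E}"

lemma schreier_zero: "schreier l 0 = {{n} | n. 1 \<le> n} \<union> {{}}"
  by (auto simp: schreier_def olimit_def intro: schreier_mem.intros elim: schreier_mem.cases)

lemma schreier_osuc:
  "schreier l (osuc g) = {{}} \<union> {\<Union>(set Es) | Es. Es \<noteq> [] \<and> (\<forall>E\<in>set Es. E \<noteq> {} \<and> E \<in> schreier l g)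
     \<and> sorted_wrt set_less Es \<and> length Es \<le> Min (hd Es)}" (is "_ = ?R")
proof
  show "schreier l (osuc g) \<subseteq> ?R"
  proof
    fix A assume "A \<in> schreier l (osuc g)"
    then have "schreier_mem l (osuc g) A" by (simp add: schreier_def)
    then show "A \<in> ?R"
      by cases (auto simp: schreier_def olimit_def)
  qed
  show "?R \<subseteq> schreier l (osuc g)"
    by (auto simp: schreier_def intro: osuc_empty osuc_Union)
qed

lemma schreier_olimit:
  assumes "olimit a"
  shows "schreier l a = {E. \<exists>k\<ge>1. (\<forall>e\<in>E. k \<le> e) \<and> E \<in> schreier l (l a k)}"
proof -
  have "schreier_mem l a E \<longleftrightarrow> (\<exists>k\<ge>1. (\<forall>e\<in>E. k \<le> e) \<and> schreier_mem l (l a k) E)" for E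
    using assms by (subst schreier_mem.simps) (auto simp: olimit_def)
  then show ?thesis by (auto simp: schreier_def)
qed

definition increasing_to :: "(nat \<Rightarrow> omega1) \<Rightarrow> omega1 \<Rightarrow> bool" where
  "increasing_to s a \<longleftrightarrow> strict_mono_on {1..} s \<and> (SUP n\<in>{1..}. s n) = a"

definition admissible_sequences :: "(omega1 \<Rightarrow> nat \<Rightarrow> omega1) \<Rightarrow> bool" where
  "admissible_sequences l \<longleftrightarrow>
     (\<forall>a. olimit a \<longrightarrow> (\<forall>n\<ge>1. 1 \<le> l a n \<and> l a n < a) \<and> increasing_to (l a) a) \<and>
     (\<forall>ps x m. let a = cnf_sum (ps @ [(x, m)]) in
        cantor_normal_form (ps @ [(x, m)]) \<and> olimit a \<and> (ps \<noteq> [] \<or> 2 \<le> m) \<longrightarrow>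
        (\<forall>n\<ge>1. l a n = cnf_sum (ps @ [(x, m - 1)]) + l (omega_pow x) n)) \<and>
     (\<forall>k x. 1 \<le> x \<and> x \<le> omega_pow k \<longrightarrow>
        (\<exists>t. increasing_to t (omega_pow x) \<and>
           (\<forall>n\<ge>1. l (omega_pow (omega_pow k + x)) n = omega_pow (omega_pow k) * t n))) \<and>
     (\<forall>g. olimit (omega_pow g) \<longrightarrow>
        (\<forall>n\<ge>1. schreier l (l (omega_pow g) n) \<subseteq> schreier l (l (omega_pow g) (n + 1))))"

text \<open>The relation \<open>rep_avg_graph l \<alpha> A a r\<close> stands for \<open>z\<^bsub>(\<alpha>,A)\<^esub>(a) = r\<close>.\<close>

inductive rep_avg_graph ::
    "(omega1 \<Rightarrow> nat \<Rightarrow> omega1) \<Rightarrow> omega1 \<Rightarrow> nat set \<Rightarrow> nat \<Rightarrow> real \<Rightarrow> bool"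
  for l :: "omega1 \<Rightarrow> nat \<Rightarrow> omega1" where
  zero: "{n} \<in> prec_maximal (schreier l 0) \<Longrightarrow> rep_avg_graph l 0 {n} n 1"
| osuc: "\<Union>(set As) \<in> prec_maximal (schreier l (osuc g)) \<Longrightarrow> \<forall>A\<in>set As. A \<in> prec_maximal (schreier l g) \<Longrightarrow>
    sorted_wrt set_less As \<Longrightarrow> length As = Min (\<Union>(set As)) \<Longrightarrow>
    A \<in> set As \<Longrightarrow> rep_avg_graph l g A a r \<Longrightarrow>
    rep_avg_graph l (osuc g) (\<Union>(set As)) a (1 / real (Min (\<Union>(set As))) * r)"
| olimit: "olimit b \<Longrightarrow> A \<in> prec_maximal (schreier l b) \<Longrightarrow> rep_avg_graph l (l b (Min A)) A a r \<Longrightarrow>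
    rep_avg_graph l b A a r"

definition rep_avg :: "(omega1 \<Rightarrow> nat \<Rightarrow> omega1) \<Rightarrow> omega1 \<Rightarrow> nat set \<Rightarrow> nat \<Rightarrow> real" where
  "rep_avg l \<alpha> A a = (THE r. rep_avg_graph l \<alpha> A a r)"

definition zeta :: "(omega1 \<Rightarrow> nat \<Rightarrow> omega1) \<Rightarrow> omega1 \<Rightarrow> nat set \<Rightarrow> real" where
  "zeta l \<alpha> A =
     (if A = {} then 0
      else rep_avg l \<alpha> (SOME B. B \<in> prec_maximal (schreier l \<alpha>) \<and> init_seg A B) (Max A))"

definition largest_common_init_seg :: "nat set \<Rightarrow> nat set \<Rightarrow> nat set" where
  "largest_common_init_seg A B =
     (THE C. init_seg C A \<and> init_seg C B \<and> (\<forall>D. init_seg D A \<and> init_seg D B \<longrightarrow> init_seg D C))"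

definition schreier_dist ::
    "(omega1 \<Rightarrow> nat \<Rightarrow> omega1) \<Rightarrow> omega1 \<Rightarrow> nat set \<Rightarrow> nat set \<Rightarrow> real" where
  "schreier_dist l \<alpha> A B =
     (let C = largest_common_init_seg A B
      in (\<Sum>D | proper_init_seg C D \<and> init_seg D A. zeta l \<alpha> D) + (\<Sum>D | proper_init_seg C D \<and> init_seg D B. zeta l \<alpha> D))"

section \<open>The Szlenk index\<close>

text \<open>On a dual space the topology of pointwise convergence is the weak-star topology.\<close>

abbreviation weak_star_topology :: "('a::real_normed_vector \<Rightarrow>\<^sub>L real) topology" where
  "weak_star_topology \<equiv> strong_operator_topology"

lemma limitin_weak_star_iff:
  "limitin weak_star_topology s y F \<longleftrightarrow> (\<forall>x. ((\<lambda>n. blinfun_apply (s n) x) \<longlongrightarrow> blinfun_apply y x) F)"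
proof
  assume "limitin weak_star_topology s y F"
  then show "\<forall>x. ((\<lambda>n. blinfun_apply (s n) x) \<longlongrightarrow> blinfun_apply y x) F"
    using continuous_map_limit[OF strong_operator_topology_continuous_evaluation]
    by (fastforce simp: o_def)
next
  assume "\<forall>x. ((\<lambda>n. blinfun_apply (s n) x) \<longlongrightarrow> blinfun_apply y x) F"
  then have "limitin (product_topology (\<lambda>i. euclidean) UNIV) (\<lambda>n. blinfun_apply (s n))
      (blinfun_apply y) F"
    by (subst limitin_componentwise) auto
  then have "limitin euclidean (\<lambda>n. blinfun_apply (s n)) (blinfun_apply y) F"
    by (simp add: euclidean_product_topology)
  then show "limitin weak_star_topology s y F"
    unfolding limitin_def strong_operator_topology_def
    by (auto simp: openin_pullback_topology topspace_pullback_topology)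
qed

definition szlenk_derivative ::
    "real \<Rightarrow> ('a::real_normed_vector \<Rightarrow>\<^sub>L real) set \<Rightarrow> ('a \<Rightarrow>\<^sub>L real) set" where
  "szlenk_derivative \<epsilon> K =
     {y. \<exists>s. (\<forall>n. s n \<in> K) \<and> limitin weak_star_topology s y sequentially \<and>
           (\<forall>n. norm (s n - y) > \<epsilon>)}"

function szlenk_derivative_iter ::
    "real \<Rightarrow> ('a::real_normed_vector \<Rightarrow>\<^sub>L real) set \<Rightarrow> omega1 \<Rightarrow> ('a \<Rightarrow>\<^sub>L real) set" where
  "szlenk_derivative_iter \<epsilon> K a =
     (if a = 0 then K
      else if \<exists>b. a = osuc b
           then szlenk_derivative \<epsilon> (szlenk_derivative_iter \<epsilon> K (THE b. a = osuc b))
      else (\<Inter>b\<in>{..<a}. szlenk_derivative_iter \<epsilon> K b))"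
  by auto
termination
  by (relation "inv_image {(x, y). x < y} (snd \<circ> snd)") (auto intro: wf wf_inv_image)

declare szlenk_derivative_iter.simps [simp del]

lemma szlenk_derivative_iter_zero: "szlenk_derivative_iter \<epsilon> K 0 = K"
  by (subst szlenk_derivative_iter.simps) simp

lemma szlenk_derivative_iter_osuc:
  "szlenk_derivative_iter \<epsilon> K (osuc a) = szlenk_derivative \<epsilon> (szlenk_derivative_iter \<epsilon> K a)"
  by (subst szlenk_derivative_iter.simps) simp

lemma szlenk_derivative_iter_olimit:
  "olimit a \<Longrightarrow> szlenk_derivative_iter \<epsilon> K a = (\<Inter>b\<in>{..<a}. szlenk_derivative_iter \<epsilon> K b)"
  by (subst szlenk_derivative_iter.simps) (simp add: olimit_def)

definition szlenk_index :: "'a::real_normed_vector itself \<Rightarrow> omega1 top" where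
  "szlenk_index _ =
     (SUP \<epsilon>\<in>{0<..}.
        SUP a\<in>{a. szlenk_derivative_iter \<epsilon> (cball 0 1 :: ('a \<Rightarrow>\<^sub>L real) set) a \<noteq> {}}. top.Value a)"

section \<open>Bi-Lipschitz embeddings\<close>

definition bilipschitz_embeds ::
    "'s set \<Rightarrow> ('s \<Rightarrow> 's \<Rightarrow> real) \<Rightarrow> 'a::metric_space itself \<Rightarrow> bool" where
  "bilipschitz_embeds M d _ \<longleftrightarrow>
     (\<exists>f :: 's \<Rightarrow> 'a. \<exists>c>0. \<exists>C>0. \<forall>x\<in>M. \<forall>y\<in>M.
        c * d x y \<le> dist (f x) (f y) \<and> dist (f x) (f y) \<le> C * d x y)"

end

theory Submission
  imports Defs
begin

text \<open>The tree \<open>S\<^bsub>\<alpha>\<^esub>\<close>, ordered by initial segments, has rank at most \<open>\<omega>\<^sup>\<alpha>\<close>. If the Szlenk index of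
  \<open>Z\<close> exceeds \<open>\<omega>\<^sup>\<alpha>\<close>, functionals \<open>y\<^sub>A\<close> in the \<open>\<rho>(A)\<close>-th derivative of the dual ball can
  therefore be chosen along the tree, together with vectors \<open>z\<^sub>A\<close> in the unit ball of \<open>Z\<close> for which
  \<open>y\<^sub>D(z\<^sub>E)\<close> is bounded below if \<open>E \<preceq> D\<close> and is small otherwise. Both \<open>A \<mapsto> \<Sum>\<^bsub>D\<preceq>A\<^esub> \<zeta>(D) z\<^sub>D\<close>, tested
  against \<open>y\<^sub>A - y\<^sub>B\<close>, and \<open>A \<mapsto> \<Sum>\<^bsub>D\<preceq>A\<^esub> \<zeta>(D) y\<^sub>D\<close>, tested against the vector \<open>z\<^sub>E\<close> of the first node
  where the branches separate, are then bi-Lipschitz. For \<open>Z = X\<^sup>*\<close> the functionals \<open>y\<^sub>D\<close> lie in the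
  bidual of \<open>X\<close> and are replaced by elements of \<open>X\<close> agreeing with them on finitely many \<open>z\<^sub>E\<close>. Of the
  weights \<open>\<zeta>\<close> only nonnegativity is used.\<close>

section \<open>Ordinal arithmetic\<close>

text \<open>Two obstacles shape the proof. The weights are given by description operators, so even
  their sign requires the repeated averages to exist and be unique. At successors this rests on the
  unique splitting of a maximal set \<open>B\<close> into \<open>Min B\<close> maximal blocks. At
  limits it rests on \<open>S (l a n)\<close> growing with \<open>n\<close>, which is assumed only
  for powers of \<open>omega\<close> and has to be transported along Cantor normal forms; this is
  the main reason for the ordinal arithmetic. The second obstacle is that the ball of Z carries no
  compactness. Nodes are therefore treated one at a time in the order of their binary codes, which
  puts initial segments first and leaves only finitely many earlier vectors and functionals to
  respect. Weak-star convergence makes the new functional increment small on the earlier vectors,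
  and differences of almost norming vectors make the new vector small under the earlier functionals.
  The ratio 3 between large and small values is what lets a single functional see one branch in
  spite of the other.\<close>

lemma plus_right_strict_mono_omega1: "b < c \<Longrightarrow> a + b < a + (c::omega1)"
  using osuc_plus_le[of b c a] by (simp add: osuc_le_iff)

lemma plus_right_le_iff_omega1: "a + b \<le> a + c \<longleftrightarrow> b \<le> (c::omega1)"
  by (meson not_le plus_right_mono_omega1 plus_right_strict_mono_omega1)

lemma plus_right_less_iff_omega1: "a + b < a + c \<longleftrightarrow> b < (c::omega1)"
  by (meson not_le plus_right_le_iff_omega1)

lemma olimit_least:
  assumes "olimit b" and "\<And>c. c < b \<Longrightarrow> f c \<le> (x::omega1)"
  shows "(SUP c\<in>{..<b}. f c) \<le> x"
  by (rule cSUP_least) (use assms in \<open>auto simp: olimit_def lessThan_omega1_eq_empty_iff\<close>)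

lemma olimit_plus:
  assumes "olimit b"
  shows "olimit (a + b)"
proof -
  have "a + b \<noteq> osuc c" for c
  proof
    assume c: "a + b = osuc c"
    have "a + b \<le> c"
    proof (subst plus_omega1_olimit[OF assms], rule olimit_least[OF assms])
      fix d assume "d < b"
      then show "a + d \<le> c"
        using c osuc_plus_le[of d b a] by (metis less_osuc not_less osuc_le_iff order.strict_trans2)
    qed
    then show False using c by (metis less_osuc not_less)
  qed
  moreover have "0 < a + b"
  proof -
    have "0 < b" using assms by (simp add: olimit_def zero_less_omega1_iff)
    from plus_right_strict_mono_omega1[OF this, of a] show ?thesis
      by (meson le_less_trans zero_le_omega1)
  qed
  ultimately show ?thesis by (auto simp: olimit_def)
qed

lemma plus_assoc_omega1: "(a + b) + c = a + (b + (c::omega1))"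
proof (induction c rule: less_induct)
  case (less c)
  show ?case
  proof (cases c rule: omega1_cases)
    case zero
    then show ?thesis by simp
  next
    case (osuc d)
    then show ?thesis using less.IH[of d] by (simp add: plus_omega1_osuc)
  next
    case olimit
    show ?thesis
    proof (rule antisym)
      show "a + b + c \<le> a + (b + c)"
      proof (subst plus_omega1_olimit[OF olimit], rule olimit_least[OF olimit])
        fix d assume "d < c"
        then show "a + b + d \<le> a + (b + c)"
          using less.IH by (simp add: plus_right_mono_omega1 less_imp_le)
      qed
      show "a + (b + c) \<le> a + b + c"
      proof (subst plus_omega1_olimit[OF olimit_plus[OF olimit]],
          rule olimit_least[OF olimit_plus[OF olimit]])
        fix d assume d: "d < b + c"
        have "\<exists>e<c. d \<le> b + e"
        proof (rule ccontr)
          assume "\<not> ?thesis"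
          then have "b + c \<le> d"
            by (subst plus_omega1_olimit[OF olimit]) (auto intro!: olimit_least[OF olimit])
          with d show False by simp
        qed
        then obtain e where e: "e < c" "d \<le> b + e" by blast
        have "a + d \<le> a + (b + e)" using e by (simp add: plus_right_mono_omega1)
        also have "\<dots> = a + b + e" using less.IH e by simp
        also have "\<dots> \<le> a + b + c" using e by (simp add: plus_right_mono_omega1)
        finally show "a + d \<le> a + b + c" .
      qed
    qed
  qed
qed

text \<open>The least \<open>c\<close> with \<open>b \<le> a + c\<close> works: \<open>a + d\<close>
  stays below \<open>b\<close> for \<open>d < c\<close>, and addition is continuous in its right
  argument.\<close>

lemma le_imp_plus_omega1:
  assumes "a \<le> (b::omega1)"
  shows "\<exists>c. b = a + c"
proof -
  define c where "c = (LEAST c. b \<le> a + c)"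
  have "b \<le> 0 + b" by simp
  then have "b \<le> a + b"
    using plus_left_mono_omega1[of 0 a b] by (meson order_trans zero_le_omega1)
  then have c: "b \<le> a + c" unfolding c_def by (rule LeastI)
  have least: "a + d < b" if "d < c" for d
    using that not_less_Least unfolding c_def by (meson not_le)
  have "a + c \<le> b"
  proof (cases c rule: omega1_cases)
    case zero
    then show ?thesis using assms by simp
  next
    case (osuc d)
    then show ?thesis using least[of d] by (simp add: plus_omega1_osuc osuc_le_iff)
  next
    case olimit
    show ?thesis
      by (subst plus_omega1_olimit[OF olimit], rule olimit_least[OF olimit]) (simp add: least less_imp_le)
  qed
  with c show ?thesis by (metis antisym)
qed

lemma less_omega_imp_nat_ord: "a < omega \<Longrightarrow> \<exists>n. a = nat_ord n"
proof (induction a rule: less_induct)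
  case (less a)
  show ?case
  proof (cases a rule: omega1_cases)
    case zero
    then show ?thesis by (metis nat_ord.simps(1))
  next
    case (osuc b)
    then have "b < a" by simp
    then obtain n where "b = nat_ord n" using less by (meson less_trans)
    then show ?thesis using osuc by (metis nat_ord.simps(2))
  next
    case olimit
    then show ?thesis using omega_least_olimit less.prems by (simp add: not_less[symmetric])
  qed
qed

lemma omega_pow_pos: "0 < omega_pow a"
  using omega_pow_mono[of 0 a] less_osuc[of 0]
  by (simp add: one_omega1_def less_le_trans del: less_osuc)

lemma omega_pow_times_nat_ord_less: "omega_pow a * nat_ord n < omega_pow a * omega"
proof -
  have "omega_pow a * nat_ord n < omega_pow a * nat_ord (Suc n)"
    using plus_right_strict_mono_omega1[OF omega_pow_pos[of a], of "omega_pow a * nat_ord n"]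
    by (simp add: times_omega1_osuc)
  also have "\<dots> \<le> omega_pow a * omega"
    by (intro times_right_mono_omega1 nat_ord_le_omega)
  finally show ?thesis .
qed

lemma omega_pow_strict_mono: "a < b \<Longrightarrow> omega_pow a < omega_pow b"
  using omega_pow_times_nat_ord_less[of a "Suc 0"] omega_pow_times_le[of a b]
  by (simp add: one_omega1_def[symmetric])

lemma omega_pow_less_iff: "omega_pow a < omega_pow b \<longleftrightarrow> a < b"
  by (meson not_le omega_pow_mono omega_pow_strict_mono)

lemma le_omega_pow: "a \<le> omega_pow a"
proof (induction a rule: less_induct)
  case (less a)
  show ?case
  proof (rule ccontr)
    assume "\<not> a \<le> omega_pow a"
    then have "omega_pow a < a" by simp
    then show False
      using less[of "omega_pow a"] omega_pow_strict_mono[of "omega_pow a" a] by simp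
  qed
qed

text \<open>One step of the Cantor normal form algorithm. By continuity, the least \<open>y\<close>
  with \<open>a < omega_pow y\<close> and then the least \<open>b\<close> with
  \<open>a < omega_pow x * b\<close> are successors; \<open>b \<le> omega\<close> makes the quotient
  finite.\<close>

lemma omega_pow_decomp:
  assumes "a \<noteq> 0"
  shows "\<exists>x m r. a = omega_pow x * nat_ord m + r \<and> 1 \<le> m \<and> r < omega_pow x"
proof -
  define y where "y = (LEAST y. a < omega_pow y)"
  have "a < omega_pow (osuc a)"
    using le_omega_pow[of "osuc a"] by (meson less_osuc less_le_trans)
  then have y: "a < omega_pow y" unfolding y_def by (rule LeastI)
  have least: "omega_pow d \<le> a" if "d < y" for d
    using that not_less_Least unfolding y_def by (meson not_le)
  have "y \<noteq> 0"
  proof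
    assume "y = 0"
    with y have "a < osuc 0" by (simp add: one_omega1_def)
    then show False using assms by (metis not_le osuc_le_iff zero_less_omega1_iff)
  qed
  moreover have "\<not> olimit y"
  proof
    assume "olimit y"
    then have "omega_pow y \<le> a"
      by (subst omega_pow_olimit) (auto intro!: olimit_least least)
    with y show False by simp
  qed
  ultimately obtain x where x: "y = osuc x" by (meson olimit_def)
  define w where "w = omega_pow x"
  define b where "b = (LEAST b. a < w * b)"
  have "a < w * omega" using y x by (simp add: omega_pow_osuc w_def)
  then have b: "a < w * b" "b \<le> omega" unfolding b_def by (rule LeastI, rule Least_le)
  have lb: "w * d \<le> a" if "d < b" for d
    using that not_less_Least unfolding b_def by (meson not_le)
  have "b \<noteq> 0" using b by auto
  moreover have "\<not> olimit b"
  proof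
    assume "olimit b"
    then have "w * b \<le> a"
      by (subst times_omega1_olimit) (auto intro!: olimit_least lb)
    with b show False by simp
  qed
  ultimately obtain d where d: "b = osuc d" by (meson olimit_def)
  have "d < omega" using b(2) d by (simp add: osuc_le_iff)
  then obtain m where m: "d = nat_ord m" using less_omega_imp_nat_ord by blast
  have "w * nat_ord m \<le> a" using lb[of d] d m by simp
  then obtain r where r: "a = w * nat_ord m + r" using le_imp_plus_omega1 by blast
  have "a < w * nat_ord m + w" using b(1) d m by (simp add: times_omega1_osuc)
  then have "r < w" using r by (simp add: plus_right_less_iff_omega1)
  moreover have "m \<noteq> 0"
  proof
    assume "m = 0"
    then have "a = r" using r by simp
    with \<open>r < w\<close> least[of x] x show False by (simp add: w_def)
  qed
  ultimately show ?thesis using r unfolding w_def by (metis Suc_leI neq0_conv One_nat_def)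
qed

lemma le_times_nat_ord:
  assumes "1 \<le> m"
  shows "a \<le> a * nat_ord m"
proof -
  obtain k where "m = Suc k" using assms by (cases m) auto
  then have "1 \<le> nat_ord m"
    by (simp add: one_omega1_def osuc_le_iff zero_less_omega1_iff)
  then show ?thesis using times_right_mono_omega1[of 1 "nat_ord m" a] by simp
qed

lemma cantor_normal_form_Cons:
  "cantor_normal_form (p # ps) \<longleftrightarrow>
     (\<forall>q\<in>set ps. fst q < fst p) \<and> 1 \<le> snd p \<and> cantor_normal_form ps"
  by (auto simp: cantor_normal_form_def)

lemma cnf_sum_append: "cnf_sum (ps @ qs) = cnf_sum ps + cnf_sum qs"
  by (induction ps rule: cnf_sum.induct) (auto simp: plus_assoc_omega1)

lemma omega_pow_le_cnf_sum:
  assumes "cantor_normal_form ps" "p \<in> set ps"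
  shows "omega_pow (fst p) \<le> cnf_sum ps"
  using assms
proof (induction ps)
  case (Cons q ps)
  obtain x m where q: "q = (x, m)" by force
  have m: "1 \<le> m" using Cons.prems q by (simp add: cantor_normal_form_Cons)
  have *: "omega_pow x \<le> omega_pow x * nat_ord m" using m by (rule le_times_nat_ord)
  have "omega_pow (fst p) \<le> omega_pow x"
    using Cons.prems q by (auto simp: cantor_normal_form_Cons intro!: omega_pow_mono intro: less_imp_le)
  with * show ?case unfolding q by (auto intro: order_trans le_plus_omega1)
qed simp

text \<open>Condition (1) on the sequences \<open>l\<close> is phrased for normal forms, so it
  reaches an arbitrary limit ordinal only through this existence statement.\<close>

lemma cantor_normal_form_exists: "\<exists>ps. cantor_normal_form ps \<and> cnf_sum ps = a"
proof (induction a rule: less_induct)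
  case (less a)
  show ?case
  proof (cases "a = 0")
    case True
    then show ?thesis by (intro exI[of _ "[]"]) (simp add: cantor_normal_form_def)
  next
    case False
    then obtain x m r where r: "a = omega_pow x * nat_ord m + r" "1 \<le> m" "r < omega_pow x"
      using omega_pow_decomp by blast
    have "r < a"
    proof -
      have "omega_pow x \<le> a"
        using r(1) le_times_nat_ord[OF r(2), of "omega_pow x"] by (metis le_plus_omega1 order_trans)
      with r(3) show ?thesis by simp
    qed
    then obtain ps where ps: "cantor_normal_form ps" "cnf_sum ps = r" using less by blast
    have "fst q < x" if "q \<in> set ps" for q
      using omega_pow_le_cnf_sum[OF ps(1) that] ps(2) r(3)
      by (metis le_less_trans omega_pow_less_iff)
    with ps r show ?thesis
      by (intro exI[of _ "(x, m) # ps"]) (auto simp: cantor_normal_form_Cons)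
  qed
qed

lemma olimit_cantor_normal_form:
  assumes "olimit a"
  obtains ps x m where "cantor_normal_form (ps @ [(x, m)])" "a = cnf_sum (ps @ [(x, m)])" "1 \<le> m"
proof -
  obtain qs where qs: "cantor_normal_form qs" "cnf_sum qs = a"
    using cantor_normal_form_exists by blast
  have "qs \<noteq> []" using qs(2) assms by (auto simp: olimit_def)
  then obtain ps p where "qs = ps @ [p]" by (metis append_butlast_last_id)
  then show ?thesis using that[of ps "fst p" "snd p"] qs
    by (auto simp: cantor_normal_form_def)
qed

section \<open>Schreier families\<close>

lemma init_seg_refl [simp]: "init_seg A A"
  by (simp add: init_seg_def)

lemma init_seg_empty [simp]: "init_seg {} A"
  by (simp add: init_seg_def)

lemma init_seg_trans: "init_seg A B \<Longrightarrow> init_seg B C \<Longrightarrow> init_seg A C"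
  unfolding init_seg_def by blast

lemma init_seg_antisym: "init_seg A B \<Longrightarrow> init_seg B A \<Longrightarrow> A = B"
  unfolding init_seg_def by blast

lemma init_seg_linear: "init_seg A C \<Longrightarrow> init_seg B C \<Longrightarrow> init_seg A B \<or> init_seg B A"
proof (rule ccontr)
  assume AC: "init_seg A C" and BC: "init_seg B C" and no: "\<not> (init_seg A B \<or> init_seg B A)"
  have "\<not> A \<subseteq> B" "\<not> B \<subseteq> A" using AC BC no by (auto simp: init_seg_def)
  then obtain a b where "a \<in> A - B" "b \<in> B - A" by blast
  then have "a < b" "b < a" using AC BC by (auto simp: init_seg_def)
  then show False by simp
qed

lemma init_seg_Int: "init_seg A B \<Longrightarrow> init_seg (A \<inter> C) (B \<inter> C)"
  unfolding init_seg_def by blast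

lemma init_seg_insert: "(\<And>a. a \<in> A \<Longrightarrow> a < q) \<Longrightarrow> init_seg A (insert q A)"
  unfolding init_seg_def by blast

lemma init_seg_Min:
  assumes "init_seg A B" "A \<noteq> {}" "finite B"
  shows "Min A = Min B"
proof (rule Min_eqI[symmetric])
  have fA: "finite A" using assms by (auto simp: init_seg_def intro: finite_subset)
  then have "Min A \<in> A" using assms(2) by simp
  then show "Min A \<in> B" using assms(1) by (auto simp: init_seg_def)
  show "Min A \<le> b" if "b \<in> B" for b
  proof (cases "b \<in> A")
    case False
    then show ?thesis using that assms Min_in[OF fA] by (auto simp: init_seg_def intro: less_imp_le)
  qed (use fA in simp)
qed (use assms in auto)

lemma proper_init_seg_iff: "proper_init_seg A B \<longleftrightarrow> init_seg A B \<and> \<not> init_seg B A"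
  unfolding proper_init_seg_def by (auto dest: init_seg_antisym)

text \<open>Empty blocks are allowed. If \<open>{}\<close> belongs to \<open>F\<close>, these are
  the unions of at most \<open>n\<close> successive members of \<open>F\<close>, in a form suited to
  induction on \<open>n\<close>.\<close>

fun blocks :: "nat set set \<Rightarrow> nat \<Rightarrow> nat set set" where
  "blocks F 0 = {{}}"
| "blocks F (Suc n) = {A \<union> B | A B. A \<in> F \<and> B \<in> blocks F n \<and> set_less A B}"

lemma set_less_empty [simp]: "set_less {} A" "set_less A {}"
  by (auto simp: set_less_def)

lemma set_less_subset: "set_less A B \<Longrightarrow> A' \<subseteq> A \<Longrightarrow> B' \<subseteq> B \<Longrightarrow> set_less A' B'"
  by (auto simp: set_less_def)

lemma set_less_UN_iff: "set_less A (\<Union>X) \<longleftrightarrow> (\<forall>B\<in>X. set_less A B)"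
  by (auto simp: set_less_def)

lemma blocks_SucI: "A \<in> F \<Longrightarrow> B \<in> blocks F n \<Longrightarrow> set_less A B \<Longrightarrow> A \<union> B \<in> blocks F (Suc n)"
  by auto

lemma blocks_empty: "{} \<in> F \<Longrightarrow> {} \<in> blocks F n"
  by (induction n) (auto intro!: exI[of _ "{}"])

lemma blocks_Suc_mono: "{} \<in> F \<Longrightarrow> B \<in> blocks F n \<Longrightarrow> B \<in> blocks F (Suc n)"
  using blocks_SucI[of "{}" F B n] by simp

lemma blocks_mono: "{} \<in> F \<Longrightarrow> m \<le> n \<Longrightarrow> blocks F m \<subseteq> blocks F n"
  by (rule lift_Suc_mono_le[of "blocks F"]) (auto intro: blocks_Suc_mono simp del: blocks.simps)

lemma blocks_of_list:
  "\<forall>E\<in>set Es. E \<in> F \<Longrightarrow> sorted_wrt set_less Es \<Longrightarrow> \<Union>(set Es) \<in> blocks F (length Es)"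
proof (induction Es)
  case (Cons E Es)
  then show ?case using blocks_SucI[of E F "\<Union>(set Es)" "length Es"] by (simp add: set_less_UN_iff)
qed simp

lemma list_of_blocks:
  "B \<in> blocks F n \<Longrightarrow>
    \<exists>Es. (\<forall>E\<in>set Es. E \<noteq> {} \<and> E \<in> F) \<and> sorted_wrt set_less Es \<and> length Es \<le> n \<and> \<Union>(set Es) = B"
proof (induction n arbitrary: B)
  case 0
  then show ?case by (intro exI[of _ "[]"]) auto
next
  case (Suc n)
  then obtain A C where B: "B = A \<union> C" "A \<in> F" "C \<in> blocks F n" "set_less A C" by auto
  with Suc.IH obtain Es where
    Es: "\<forall>E\<in>set Es. E \<noteq> {} \<and> E \<in> F" "sorted_wrt set_less Es" "length Es \<le> n" "\<Union>(set Es) = C"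
    by blast
  show ?case
  proof (cases "A = {}")
    case True
    then show ?thesis using B Es by (intro exI[of _ Es]) auto
  next
    case False
    moreover have "\<forall>E\<in>set Es. set_less A E" using B(4) Es(4) by (auto simp: set_less_UN_iff)
    ultimately show ?thesis using B Es by (intro exI[of _ "A # Es"]) auto
  qed
qed

lemma Min_Union_sorted_wrt_set_less:
  assumes "sorted_wrt set_less Es" "Es \<noteq> []" "\<forall>E\<in>set Es. E \<noteq> {} \<and> finite E"
  shows "Min (\<Union>(set Es)) = Min (hd Es)"
proof -
  obtain E Fs where Es: "Es = E # Fs" using assms(2) by (cases Es) auto
  have "init_seg E (\<Union>(set Es))" using assms(1) unfolding Es by (auto simp: init_seg_def set_less_def)
  from init_seg_Min[OF this] show ?thesis using assms(3) Es by auto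
qed

lemma blocks_hereditary:
  assumes "\<And>A B. A \<in> F \<Longrightarrow> B \<subseteq> A \<Longrightarrow> B \<in> F"
  shows "A \<in> blocks F n \<Longrightarrow> B \<subseteq> A \<Longrightarrow> B \<in> blocks F n"
proof (induction n arbitrary: A B)
  case (Suc n)
  then obtain A1 A2 where A: "A = A1 \<union> A2" "A1 \<in> F" "A2 \<in> blocks F n" "set_less A1 A2" by auto
  have "B \<inter> A1 \<in> F" "B \<inter> A2 \<in> blocks F n" "set_less (B \<inter> A1) (B \<inter> A2)" "B = (B \<inter> A1) \<union> (B \<inter> A2)"
    using assms[OF A(2)] Suc.IH[OF A(3)] A Suc.prems(2) by (auto intro: set_less_subset)
  then show ?case unfolding blocks.simps by blast
qed auto

text \<open>The largest point lies in the last nonempty block, so exchanging it concerns a single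
  member of \<open>F\<close>.\<close>

lemma blocks_insert:
  assumes ext: "\<And>A p q. insert p A \<in> F \<Longrightarrow> \<forall>a\<in>A. a < p \<Longrightarrow> \<forall>a\<in>A. a < q \<Longrightarrow> 1 \<le> q \<Longrightarrow> insert q A \<in> F"
    and "{} \<in> F"
  shows "insert p A \<in> blocks F n \<Longrightarrow> \<forall>a\<in>A. a < p \<Longrightarrow> \<forall>a\<in>A. a < q \<Longrightarrow> 1 \<le> q \<Longrightarrow> insert q A \<in> blocks F n"
proof (induction n arbitrary: A)
  case (Suc n)
  then obtain A1 B1 where A: "insert p A = A1 \<union> B1" "A1 \<in> F" "B1 \<in> blocks F n" "set_less A1 B1"
    by auto
  show ?case
  proof (cases "p \<in> A1")
    case True
    have "B1 = {}"
    proof (rule ccontr)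
      assume "B1 \<noteq> {}"
      then obtain b where b: "b \<in> B1" by blast
      then have "p < b" using True A(4) by (auto simp: set_less_def)
      moreover have "b \<in> insert p A" using A(1) b by blast
      ultimately show False using Suc.prems(2) by auto
    qed
    then have "insert q A \<in> F" using A ext[of p A q] Suc.prems by simp
    then show ?thesis
      using blocks_SucI[OF _ blocks_empty[OF \<open>{} \<in> F\<close>], of "insert q A" n] by simp
  next
    case False
    then have p: "p \<in> B1" using A(1) by blast
    have B: "B1 = insert p (B1 - {p})" "A = A1 \<union> (B1 - {p})"
      using p False A(1) Suc.prems(2) by auto
    then have "insert q (B1 - {p}) \<in> blocks F n"
      using Suc.IH[of "B1 - {p}"] A(3) Suc.prems by (metis Un_iff)
    moreover have "set_less A1 (insert q (B1 - {p}))"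
      using A(4) B(2) Suc.prems(3) by (auto simp: set_less_def)
    moreover have "insert q A = A1 \<union> insert q (B1 - {p})" using B(2) by blast
    ultimately show ?thesis using A(2) unfolding blocks.simps by blast
  qed
qed simp

section \<open>Heredity and one-point extensions in the Schreier families\<close>

locale admissible =
  fixes l :: "omega1 \<Rightarrow> nat \<Rightarrow> omega1"
  assumes admissible_l: "admissible_sequences l"
begin

lemma l_less: "olimit a \<Longrightarrow> 1 \<le> n \<Longrightarrow> l a n < a"
  using admissible_l unfolding admissible_sequences_def by blast

abbreviation "S \<equiv> schreier l"

lemma empty_in_schreier: "{} \<in> S a"
proof (induction a rule: less_induct)
  case (less a)
  show ?case
  proof (cases a rule: omega1_cases)
    case olimit
    then show ?thesis using less[OF l_less[OF olimit, of 1]] by (auto simp: schreier_olimit)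
  qed (auto simp: schreier_zero schreier_osuc)
qed

lemma schreier_finite_pos: "A \<in> S a \<Longrightarrow> finite A \<and> 0 \<notin> A"
proof (induction a arbitrary: A rule: less_induct)
  case (less a)
  show ?case
  proof (cases a rule: omega1_cases)
    case zero
    then show ?thesis using less.prems by (auto simp: schreier_zero)
  next
    case (osuc b)
    then show ?thesis using less.prems less.IH[of b] by (auto simp: schreier_osuc)
  next
    case olimit
    then show ?thesis using less.prems less.IH l_less[OF olimit] by (auto simp: schreier_olimit)
  qed
qed

text \<open>The bound by \<open>Min (hd Es)\<close> turns into a bound by the minimum of the union.
  The empty set stands apart because its \<open>Min\<close> is unspecified.\<close>

lemma schreier_osuc_blocks: "S (osuc g) = {E. E = {} \<or> E \<in> blocks (S g) (Min E)}"
proof (intro equalityI subsetI)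
  fix E assume E: "E \<in> S (osuc g)"
  show "E \<in> {E. E = {} \<or> E \<in> blocks (S g) (Min E)}"
  proof (cases "E = {}")
    case False
    with E obtain Es where Es: "Es \<noteq> []" "\<forall>E\<in>set Es. E \<noteq> {} \<and> E \<in> S g" "sorted_wrt set_less Es"
      "length Es \<le> Min (hd Es)" "E = \<Union>(set Es)"
      by (auto simp: schreier_osuc)
    have "Min E = Min (hd Es)"
      using Min_Union_sorted_wrt_set_less[OF Es(3,1)] Es(2,5) schreier_finite_pos by blast
    then have "E \<in> blocks (S g) (Min E)"
      using blocks_of_list[of Es "S g"] blocks_mono[OF empty_in_schreier, of "length Es" "Min E" g] Es by auto
    then show ?thesis by simp
  qed simp
next
  fix E assume "E \<in> {E. E = {} \<or> E \<in> blocks (S g) (Min E)}"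
  then consider "E = {}" | "E \<noteq> {}" "E \<in> blocks (S g) (Min E)" by blast
  then show "E \<in> S (osuc g)"
  proof cases
    case 2
    then obtain Es where Es: "\<forall>E\<in>set Es. E \<noteq> {} \<and> E \<in> S g" "sorted_wrt set_less Es"
      "length Es \<le> Min E" "\<Union>(set Es) = E"
      using list_of_blocks by blast
    then have "Es \<noteq> []" using 2 by auto
    moreover have "Min E = Min (hd Es)"
      using Min_Union_sorted_wrt_set_less[OF Es(2) \<open>Es \<noteq> []\<close>] Es(1,4) schreier_finite_pos by blast
    ultimately show ?thesis using Es by (auto simp: schreier_osuc)
  qed (simp add: empty_in_schreier)
qed

lemma schreier_hereditary: "A \<in> S a \<Longrightarrow> B \<subseteq> A \<Longrightarrow> B \<in> S a"
proof (induction a arbitrary: A B rule: less_induct)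
  case (less a)
  show ?case
  proof (cases a rule: omega1_cases)
    case zero
    then show ?thesis using less.prems by (auto simp: schreier_zero)
  next
    case (osuc b)
    show ?thesis
    proof (cases "B = {}")
      case False
      \<comment> \<open>Passing to a subset can only raise the minimum, hence the permitted number
        of blocks.\<close>
      then have "A \<noteq> {}" "A \<in> blocks (S b) (Min A)" "Min A \<le> Min B"
        using less.prems osuc schreier_finite_pos[OF less.prems(1)]
        by (auto simp: schreier_osuc_blocks intro: Min_antimono)
      then have "B \<in> blocks (S b) (Min A)"
        using blocks_hereditary[of "S b" A "Min A" B] less.IH[of b] less.prems(2) osuc by simp
      then show ?thesis
        using blocks_mono[OF empty_in_schreier \<open>Min A \<le> Min B\<close>] osuc
        by (auto simp: schreier_osuc_blocks)
    qed (simp add: empty_in_schreier)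
  next
    case olimit
    then obtain k where k: "1 \<le> k" "\<forall>e\<in>A. k \<le> e" "A \<in> S (l a k)"
      using less.prems by (auto simp: schreier_olimit)
    then show ?thesis using less.IH[OF l_less[OF olimit k(1)] k(3) less.prems(2)] less.prems(2) olimit
      by (auto simp: schreier_olimit)
  qed
qed

lemma schreier_init_seg: "A \<in> S a \<Longrightarrow> init_seg B A \<Longrightarrow> B \<in> S a"
  by (rule schreier_hereditary) (auto simp: init_seg_def)

lemma schreier_singleton: "1 \<le> n \<Longrightarrow> {n} \<in> S a"
proof (induction a rule: less_induct)
  case (less a)
  show ?case
  proof (cases a rule: omega1_cases)
    case (osuc b)
    then show ?thesis
      using less.IH[of b] less.prems by (auto simp: schreier_osuc intro!: exI[of _ "[{n}]"])
  next
    case olimit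
    then show ?thesis using less.IH[OF l_less[OF olimit, of 1]] less.prems
      by (auto simp: schreier_olimit)
  qed (use less.prems in \<open>simp add: schreier_zero\<close>)
qed

text \<open>Whether a set can be prolonged by one later point does not depend on that point. For
  nonempty \<open>A\<close> the minimum is unaffected by the new point, so the block count at
  successors and the bound \<open>k\<close> at limits persist; for empty \<open>A\<close> all
  singletons are available.\<close>

lemma schreier_insert:
  "insert p A \<in> S a \<Longrightarrow> \<forall>b\<in>A. b < p \<Longrightarrow> \<forall>b\<in>A. b < q \<Longrightarrow> 1 \<le> q \<Longrightarrow> insert q A \<in> S a"
proof (induction a arbitrary: A p q rule: less_induct)
  case (less a)
  show ?case
  proof (cases "A = {}")
    case True
    then show ?thesis using schreier_singleton less.prems by simp
  next
    case A: False
    have fin: "finite A" using schreier_finite_pos[OF less.prems(1)] by simp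
    show ?thesis
    proof (cases a rule: omega1_cases)
      case zero
      then show ?thesis using less.prems A by (auto simp: schreier_zero)
    next
      case (osuc b)
      have "Min (insert p A) = Min A" "Min (insert q A) = Min A"
        using init_seg_Min[OF init_seg_insert A, of p] init_seg_Min[OF init_seg_insert A, of q]
          less.prems fin by simp_all
      moreover have "insert p A \<in> blocks (S b) (Min (insert p A))"
        using less.prems(1) osuc by (simp add: schreier_osuc_blocks)
      ultimately have "insert q A \<in> blocks (S b) (Min (insert q A))"
        using blocks_insert[of "S b" p A "Min A" q] less.IH[of b] empty_in_schreier less.prems osuc by simp
      then show ?thesis using osuc by (simp add: schreier_osuc_blocks)
    next
      case olimit
      then obtain k where k: "1 \<le> k" "\<forall>e\<in>insert p A. k \<le> e" "insert p A \<in> S (l a k)"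
        using less.prems by (auto simp: schreier_olimit)
      obtain e where "e \<in> A" using A by blast
      then have "k \<le> e" "e < q" using k(2) less.prems(3) by auto
      then show ?thesis
        using less.IH[OF l_less[OF olimit k(1)] k(3)] less.prems olimit k(1,2)
        by (auto simp: schreier_olimit)
    qed
  qed
qed

text \<open>Heredity cuts a proper extension down to one extra point \<open>p\<close>, which is then
  moved to \<open>q\<close>.\<close>

lemma not_prec_maximal_insert:
  assumes "A \<in> S a" "A \<notin> prec_maximal (S a)" "\<forall>b\<in>A. b < q" "1 \<le> q"
  shows "insert q A \<in> S a"
proof -
  obtain B where B: "B \<in> S a" "init_seg A B" "A \<noteq> B"
    using assms by (auto simp: prec_maximal_def proper_init_seg_def)
  then obtain p where p: "p \<in> B - A" by (auto simp: init_seg_def)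
  then have "insert p A \<in> S a" "\<forall>b\<in>A. b < p"
    using B schreier_hereditary[OF B(1), of "insert p A"] by (auto simp: init_seg_def)
  then show ?thesis using schreier_insert assms by blast
qed

lemma prec_maximal_nonempty: "{} \<notin> prec_maximal (S a)"
  using schreier_singleton[of 1 a] by (auto simp: prec_maximal_def proper_init_seg_def)

end

text \<open>A bound on the well-founded rank of the tree. It is stated through some strictly
  decreasing labelling, because the labels themselves later index the derivatives.\<close>

definition tree_rank_le :: "nat set set \<Rightarrow> omega1 \<Rightarrow> bool" where
  "tree_rank_le F m \<longleftrightarrow> (\<exists>\<rho>. (\<forall>A\<in>F. \<rho> A \<le> m) \<and> (\<forall>A\<in>F. \<forall>B\<in>F. proper_init_seg A B \<longrightarrow> \<rho> B < \<rho> A))"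

text \<open>While a branch is still in its first block, the whole rank \<open>n\<close> of the
  second block lies ahead, which explains the order of the summands in \<open>n + m\<close>.\<close>

lemma tree_rank_le_Un:
  assumes G: "tree_rank_le G m" and H: "tree_rank_le H n"
    and Gh: "\<And>A B. A \<in> G \<Longrightarrow> B \<subseteq> A \<Longrightarrow> B \<in> G" and Hh: "\<And>A B. A \<in> H \<Longrightarrow> B \<subseteq> A \<Longrightarrow> B \<in> H"
    and fin: "\<And>A. A \<in> G \<Longrightarrow> finite A" "\<And>A. A \<in> H \<Longrightarrow> finite A"
  shows "tree_rank_le {A \<union> B | A B. A \<in> G \<and> B \<in> H \<and> set_less A B} (n + m)"
proof -
  obtain g where g: "\<And>A. A \<in> G \<Longrightarrow> g A \<le> m"
      "\<And>A B. A \<in> G \<Longrightarrow> B \<in> G \<Longrightarrow> proper_init_seg A B \<Longrightarrow> g B < g A"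
    using G unfolding tree_rank_le_def by blast
  obtain h where h: "\<And>A. A \<in> H \<Longrightarrow> h A \<le> n"
      "\<And>A B. A \<in> H \<Longrightarrow> B \<in> H \<Longrightarrow> proper_init_seg A B \<Longrightarrow> h B < h A"
    using H unfolding tree_rank_le_def by blast
  let ?F = "{A \<union> B | A B. A \<in> G \<and> B \<in> H \<and> set_less A B}"
  define dec where "dec E = {(A, B). A \<in> G \<and> B \<in> H \<and> set_less A B \<and> E = A \<union> B}" for E
  \<comment> \<open>A set can split in several ways, so the label is the maximum over all
    splittings. Each splitting of a longer set restricts to one of the shorter set with a strictly
    larger value.\<close>
  define val where "val p = (if snd p = {} then n + g (fst p) else h (snd p))" for p
  define \<rho> where "\<rho> E = Max (val ` dec E)" for E
  have fin_dec: "finite (dec E)" if "E \<in> ?F" for E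
  proof (rule finite_subset)
    show "dec E \<subseteq> Pow E \<times> Pow E" by (auto simp: dec_def)
    show "finite (Pow E \<times> Pow E)" using that fin by auto
  qed
  have ne: "dec E \<noteq> {}" if "E \<in> ?F" for E using that by (auto simp: dec_def)
  have val_le: "val p \<le> n + m" if "p \<in> dec E" for p E
    using that g(1) h(1) unfolding val_def dec_def
    by (auto intro: plus_right_mono_omega1 order_trans[OF _ le_plus_omega1])
  have "\<rho> E \<le> n + m" if "E \<in> ?F" for E
    unfolding \<rho>_def using fin_dec[OF that] ne[OF that] val_le by auto
  moreover have "\<rho> E' < \<rho> E" if E: "E \<in> ?F" "E' \<in> ?F" "proper_init_seg E E'" for E E'
  proof -
    have "val p < \<rho> E" if p_dec: "p \<in> dec E'" for p
    proof -
      obtain A B where p: "p = (A, B)" "A \<in> G" "B \<in> H" "set_less A B" "E' = A \<union> B"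
        using p_dec unfolding dec_def by blast
      have iE: "init_seg E E'" "E \<noteq> E'" using E(3) by (auto simp: proper_init_seg_def)
      have A': "init_seg (E \<inter> A) A" and B': "init_seg (E \<inter> B) B"
        using init_seg_Int[OF iE(1), of A] init_seg_Int[OF iE(1), of B] p(5)
        by (auto simp: Int_absorb1)
      have "E = (E \<inter> A) \<union> (E \<inter> B)" using iE(1) p(5) by (auto simp: init_seg_def)
      moreover have "E \<inter> A \<in> G" "E \<inter> B \<in> H" "set_less (E \<inter> A) (E \<inter> B)"
        using Gh[OF p(2)] Hh[OF p(3)] set_less_subset[OF p(4)] by auto
      ultimately have q: "(E \<inter> A, E \<inter> B) \<in> dec E" by (simp add: dec_def)
      have "val p < val (E \<inter> A, E \<inter> B)"
      proof (cases "E \<inter> B = {}")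
        case True
        show ?thesis
        proof (cases "B = {}")
          case B: True
          have "E \<inter> A \<noteq> A"
            using B iE p(5) by (metis Int_absorb2 Int_lower1 init_seg_def sup_bot.right_neutral Int_commute)
          then have "proper_init_seg (E \<inter> A) A" using A' by (simp add: proper_init_seg_def)
          then have "g A < g (E \<inter> A)" by (rule g(2)[OF \<open>E \<inter> A \<in> G\<close> p(2)])
          then show ?thesis using B p(1) by (simp add: val_def plus_right_strict_mono_omega1)
        next
          case B: False
          then have "proper_init_seg {} B" by (simp add: proper_init_seg_def)
          moreover have "{} \<in> H" using Hh[OF p(3)] by simp
          ultimately have "h B < n" using h p(3) by (meson less_le_trans)
          then show ?thesis using B True p(1) by (simp add: val_def) (meson le_plus_omega1 less_le_trans)
        qed
      next
        case False
        then obtain b where b: "b \<in> E" "b \<in> B" by blast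
        have "A \<subseteq> E"
        proof
          fix a assume "a \<in> A"
          then have "a \<in> E'" "a < b" using p(4,5) b(2) by (auto simp: set_less_def)
          then show "a \<in> E" using iE(1) b(1) unfolding init_seg_def by (metis DiffI less_asym)
        qed
        have "E \<subseteq> E'" using iE(1) by (simp add: init_seg_def)
        then have "E \<inter> B \<noteq> B" using iE(2) p(5) \<open>A \<subseteq> E\<close> by blast
        then have "proper_init_seg (E \<inter> B) B" using B' by (simp add: proper_init_seg_def)
        moreover have "B \<noteq> {}" using False by blast
        ultimately show ?thesis using h(2) p False \<open>E \<inter> B \<in> H\<close> by (simp add: val_def)
      qed
      also have "\<dots> \<le> \<rho> E" unfolding \<rho>_def using fin_dec[OF E(1)] q by simp
      finally show ?thesis .
    qed
    then show ?thesis
      unfolding \<rho>_def[of E'] using fin_dec[OF E(2)] ne[OF E(2)] by simp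
  qed
  ultimately show ?thesis unfolding tree_rank_le_def by blast
qed

section \<open>Ranks of the Schreier families\<close>

context admissible
begin

lemma blocks_schreier_hereditary: "A \<in> blocks (S g) n \<Longrightarrow> B \<subseteq> A \<Longrightarrow> B \<in> blocks (S g) n"
  using blocks_hereditary schreier_hereditary by blast

lemma blocks_schreier_finite_pos: "A \<in> blocks (S g) n \<Longrightarrow> finite A \<and> 0 \<notin> A"
  by (induction n arbitrary: A) (auto simp: schreier_finite_pos)

lemma tree_rank_blocks:
  assumes "tree_rank_le (S g) m"
  shows "tree_rank_le (blocks (S g) n) (m * nat_ord n)"
proof (induction n)
  case 0
  show ?case unfolding tree_rank_le_def
    by (rule exI[of _ "\<lambda>_. 0"]) (simp add: proper_init_seg_def)
next
  case (Suc n)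
  have "tree_rank_le (blocks (S g) (Suc n)) (m * nat_ord n + m)"
    unfolding blocks.simps
    by (rule tree_rank_le_Un[OF assms Suc]) (auto intro: schreier_hereditary blocks_schreier_hereditary
        simp: schreier_finite_pos blocks_schreier_finite_pos)
  then show ?case by (simp add: times_omega1_osuc)
qed

text \<open>Beyond the root the minimum is constant along a branch. Fixing it leaves at successors a
  family of boundedly many blocks, of rank below \<open>omega_pow a\<close>, and at limits finitely
  many candidates \<open>k\<close>; the root takes the value \<open>omega_pow a\<close>.\<close>

lemma tree_rank_schreier: "tree_rank_le (S a) (omega_pow a)"
proof (induction a rule: less_induct)
  case (less a)
  show ?case
  proof (cases a rule: omega1_cases)
    case zero
    show ?thesis unfolding tree_rank_le_def zero
      by (rule exI[of _ "\<lambda>A. if A = {} then 1 else 0"])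
        (auto simp: schreier_zero proper_init_seg_def init_seg_def one_omega1_def)
  next
    case (osuc b)
    have "\<forall>n. \<exists>\<rho>. (\<forall>A\<in>blocks (S b) n. \<rho> A \<le> omega_pow b * nat_ord n) \<and>
        (\<forall>A\<in>blocks (S b) n. \<forall>B\<in>blocks (S b) n. proper_init_seg A B \<longrightarrow> \<rho> B < \<rho> A)"
      using tree_rank_blocks[OF less.IH[of b]] osuc unfolding tree_rank_le_def by auto
    then obtain \<rho> where \<rho>: "\<And>n A. A \<in> blocks (S b) n \<Longrightarrow> \<rho> n A \<le> omega_pow b * nat_ord n"
      "\<And>n A B. A \<in> blocks (S b) n \<Longrightarrow> B \<in> blocks (S b) n \<Longrightarrow> proper_init_seg A B \<Longrightarrow> \<rho> n B < \<rho> n A"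
      by metis
    define \<sigma> where "\<sigma> A = (if A = {} then omega_pow a else \<rho> (Min A) A)" for A
    have lt: "\<sigma> A < omega_pow a" if "A \<in> S a" "A \<noteq> {}" for A
      using that \<rho>(1)[of A "Min A"] omega_pow_times_nat_ord_less[of b "Min A"] osuc
      by (auto simp: \<sigma>_def schreier_osuc_blocks omega_pow_osuc)
    moreover have "\<sigma> B < \<sigma> A" if AB: "A \<in> S a" "B \<in> S a" "proper_init_seg A B" for A B
    proof -
      have B: "B \<noteq> {}" using AB(3) by (auto simp: proper_init_seg_def init_seg_def)
      show ?thesis
      proof (cases "A = {}")
        case True
        then show ?thesis using lt[OF AB(2) B] by (simp add: \<sigma>_def)
      next
        case False
        then have "Min A = Min B"
          using AB init_seg_Min[of A B] schreier_finite_pos by (auto simp: proper_init_seg_def)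
        then show ?thesis using \<rho>(2)[of A "Min A" B] AB False B osuc
          by (auto simp: \<sigma>_def schreier_osuc_blocks)
      qed
    qed
    ultimately show ?thesis unfolding tree_rank_le_def
      by (intro exI[of _ \<sigma>]) (metis \<sigma>_def less_imp_le order.refl)
  next
    case olimit
    have "\<forall>n. 1 \<le> n \<longrightarrow> (\<exists>\<rho>. (\<forall>A\<in>S (l a n). \<rho> A \<le> omega_pow (l a n)) \<and>
        (\<forall>A\<in>S (l a n). \<forall>B\<in>S (l a n). proper_init_seg A B \<longrightarrow> \<rho> B < \<rho> A))"
      using less.IH[OF l_less[OF olimit]] unfolding tree_rank_le_def by auto
    then obtain \<rho> where \<rho>: "\<And>n A. 1 \<le> n \<Longrightarrow> A \<in> S (l a n) \<Longrightarrow> \<rho> n A \<le> omega_pow (l a n)"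
      "\<And>n A B. 1 \<le> n \<Longrightarrow> A \<in> S (l a n) \<Longrightarrow> B \<in> S (l a n) \<Longrightarrow> proper_init_seg A B \<Longrightarrow> \<rho> n B < \<rho> n A"
      by metis
    \<comment> \<open>Taking the maximum over all witnesses \<open>k\<close> works because every
      witness for a set is also one for its nonempty initial segments.\<close>
    define K where "K A = {k. 1 \<le> k \<and> k \<le> Min A \<and> A \<in> S (l a k)}" for A
    define \<sigma> where "\<sigma> A = (if A = {} then omega_pow a else Max ((\<lambda>k. \<rho> k A) ` K A))" for A
    have finK: "finite (K A)" for A by (rule finite_subset[of _ "{..Min A}"]) (auto simp: K_def)
    have neK: "K A \<noteq> {}" if "A \<in> S a" "A \<noteq> {}" for A
      using that schreier_finite_pos[OF that(1)] olimit by (auto simp: K_def schreier_olimit)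
    have lt: "\<sigma> A < omega_pow a" if A: "A \<in> S a" "A \<noteq> {}" for A
    proof -
      have "\<rho> k A < omega_pow a" if "k \<in> K A" for k
        using that \<rho>(1)[of k A] omega_pow_strict_mono[OF l_less[OF olimit, of k]] by (auto simp: K_def)
      then show ?thesis using finK neK[OF A] A by (simp add: \<sigma>_def)
    qed
    moreover have "\<sigma> B < \<sigma> A" if AB: "A \<in> S a" "B \<in> S a" "proper_init_seg A B" for A B
    proof -
      have B: "B \<noteq> {}" using AB(3) by (auto simp: proper_init_seg_def init_seg_def)
      show ?thesis
      proof (cases "A = {}")
        case True
        then show ?thesis using lt[OF AB(2) B] by (simp add: \<sigma>_def)
      next
        case False
        then have M: "Min A = Min B"
          using AB init_seg_Min[of A B] schreier_finite_pos by (auto simp: proper_init_seg_def)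
        have "\<rho> k B < \<sigma> A" if "k \<in> K B" for k
        proof -
          have k: "1 \<le> k" "k \<le> Min B" "B \<in> S (l a k)" using that by (auto simp: K_def)
          then have "A \<in> S (l a k)" using AB(3) schreier_init_seg by (auto simp: proper_init_seg_def)
          then have "\<rho> k B < \<rho> k A" "k \<in> K A" using \<rho>(2) k AB(3) M by (auto simp: K_def)
          then show ?thesis using finK[of A] False by (auto simp: \<sigma>_def intro: less_le_trans)
        qed
        then show ?thesis using finK[of B] neK[OF AB(2) B] B by (simp add: \<sigma>_def[of B])
      qed
    qed
    ultimately show ?thesis unfolding tree_rank_le_def
      by (intro exI[of _ \<sigma>]) (metis \<sigma>_def less_imp_le order.refl)
  qed
qed

end

section \<open>Nonnegativity of the weights\<close>

definition separated :: "nat set set \<Rightarrow> bool" where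
  "separated X \<longleftrightarrow> finite X \<and> (\<forall>A\<in>X. \<forall>B\<in>X. A \<noteq> B \<longrightarrow> set_less A B \<or> set_less B A)"

text \<open>This is the family usually written \<open>G[F]\<close>. Monotonicity of \<open>n \<mapsto> S\<^bsub>\<lambda>(\<alpha>,n)\<^esub>\<close> is only assumed
  for powers of \<open>\<omega>\<close>; the general case follows from \<open>S\<^bsub>\<beta>+\<gamma>\<^esub> = S\<^bsub>\<gamma>\<^esub>[S\<^bsub>\<beta>\<^esub>]\<close>, valid when the Cantor
  normal forms of \<open>\<beta>\<close> and \<open>\<gamma>\<close> can be concatenated.\<close>

definition convolution :: "nat set set \<Rightarrow> nat set set \<Rightarrow> nat set set" where
  "convolution G F = {\<Union>X | X. separated X \<and> X \<subseteq> F - {{}} \<and> Min ` X \<in> G}"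

lemma convolution_mono: "G \<subseteq> G' \<Longrightarrow> convolution G F \<subseteq> convolution G' F"
  by (auto simp: convolution_def)

text \<open>Nonempty separated sets are ordered like their minima, so a splitting of the set of
  minima into blocks is the same as a splitting of the union. This is the successor step of
  \<open>schreier_plus\<close>.\<close>

lemma convolution_blocks:
  assumes fin: "\<And>A. A \<in> F \<Longrightarrow> finite A"
  shows "convolution (blocks G n) F = blocks (convolution G F) n"
proof (induction n)
  case 0
  show ?case
    by (auto simp: convolution_def separated_def intro!: exI[of _ "{}"])
next
  case (Suc n)
  show ?case
  proof (intro equalityI subsetI)
    fix E assume "E \<in> convolution (blocks G (Suc n)) F"
    then obtain X where X: "separated X" "X \<subseteq> F - {{}}" "E = \<Union>X" "Min ` X \<in> blocks G (Suc n)"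
      by (auto simp: convolution_def)
    then obtain M1 M2 where M: "Min ` X = M1 \<union> M2" "M1 \<in> G" "M2 \<in> blocks G n" "set_less M1 M2" by auto
    define X1 where "X1 = {A\<in>X. Min A \<in> M1}"
    define X2 where "X2 = {A\<in>X. Min A \<in> M2}"
    have XX: "X = X1 \<union> X2" using M(1) by (auto simp: X1_def X2_def)
    have "Min ` X1 = M1" "Min ` X2 = M2" using M(1) by (auto simp: X1_def X2_def image_iff)
    moreover have "separated X1" "separated X2" using X(1) by (auto simp: separated_def X1_def X2_def)
    ultimately have "\<Union>X1 \<in> convolution G F" "\<Union>X2 \<in> convolution (blocks G n) F"
      using XX X(2) M(2,3) by (auto simp: convolution_def)
    moreover have "set_less (\<Union>X1) (\<Union>X2)"
    proof -
      have "set_less A B" if A: "A \<in> X1" and B: "B \<in> X2" for A B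
      proof -
        have lt: "Min A < Min B" using A B M(4) by (auto simp: X1_def X2_def set_less_def)
        have ne: "A \<noteq> {}" "B \<noteq> {}" "finite A" "finite B" using A B X(2) fin by (auto simp: X1_def X2_def)
        then have "\<not> set_less B A" using lt Min_in by (metis less_asym set_less_def)
        moreover have "A \<noteq> B" using lt by auto
        ultimately show ?thesis using X(1) A B by (auto simp: separated_def X1_def X2_def)
      qed
      then show ?thesis by (auto simp: set_less_def)
    qed
    moreover have "E = \<Union>X1 \<union> \<Union>X2" using X(3) XX by auto
    ultimately show "E \<in> blocks (convolution G F) (Suc n)" unfolding Suc blocks.simps by blast
  next
    fix E assume "E \<in> blocks (convolution G F) (Suc n)"
    then obtain A B where E: "E = A \<union> B" "A \<in> convolution G F" "B \<in> convolution (blocks G n) F" "set_less A B"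
      unfolding Suc blocks.simps by blast
    obtain X where X: "separated X" "X \<subseteq> F - {{}}" "A = \<Union>X" "Min ` X \<in> G"
      using E(2) by (auto simp: convolution_def)
    obtain Y where Y: "separated Y" "Y \<subseteq> F - {{}}" "B = \<Union>Y" "Min ` Y \<in> blocks G n"
      using E(3) by (auto simp: convolution_def)
    have lt: "set_less C D" if "C \<in> X" "D \<in> Y" for C D
      using E(4) X(3) Y(3) that by (auto simp: set_less_def)
    have "separated (X \<union> Y)" using X(1) Y(1) lt by (auto simp: separated_def)
    moreover have "set_less (Min ` X) (Min ` Y)"
    proof -
      have "Min C < Min D" if "C \<in> X" "D \<in> Y" for C D
      proof -
        have "finite C" "C \<noteq> {}" "finite D" "D \<noteq> {}" using that X(2) Y(2) fin by auto
        then show ?thesis using lt[OF that] Min_in by (auto simp: set_less_def)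
      qed
      then show ?thesis by (auto simp: set_less_def)
    qed
    then have "Min ` (X \<union> Y) \<in> blocks G (Suc n)" using X(4) Y(4) by (auto simp: image_Un)
    ultimately show "E \<in> convolution (blocks G (Suc n)) F"
      unfolding convolution_def using X(2,3) Y(2,3) E(1) by (auto intro!: exI[of _ "X \<union> Y"])
  qed
qed

text \<open>Ensures that the set of minima and the union are allowed the same number of blocks at a
  successor.\<close>

lemma Min_Min_image:
  assumes "finite X" "\<forall>A\<in>X. finite A \<and> A \<noteq> {}" "X \<noteq> {}"
  shows "Min (Min ` X) = Min (\<Union>X)"
proof (rule Min_eqI[symmetric])
  have "Min (Min ` X) \<in> Min ` X" using assms by (intro Min_in) auto
  then show "Min (Min ` X) \<in> \<Union>X" using assms Min_in by fastforce
  fix b assume "b \<in> \<Union>X"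
  then obtain A where A: "A \<in> X" "b \<in> A" by blast
  then have "Min (Min ` X) \<le> Min A" using assms(1) by (intro Min_le) auto
  also have "\<dots> \<le> b" using A assms by simp
  finally show "Min (Min ` X) \<le> b" .
qed (use assms in auto)

section \<open>Monotonicity of the approximating families at arbitrary limits\<close>

context admissible
begin

lemma increasing_pure_power:
  "olimit (omega_pow g) \<Longrightarrow> 1 \<le> n \<Longrightarrow> S (l (omega_pow g) n) \<subseteq> S (l (omega_pow g) (n + 1))"
  using admissible_l unfolding admissible_sequences_def by blast

lemma l_cnf_sum:
  assumes "cantor_normal_form (ps @ [(x, m)])" "olimit (cnf_sum (ps @ [(x, m)]))" "1 \<le> n"
  shows "l (cnf_sum (ps @ [(x, m)])) n = cnf_sum (ps @ [(x, m - 1)]) + l (omega_pow x) n"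
proof (cases "ps \<noteq> [] \<or> 2 \<le> m")
  case True
  then show ?thesis using assms admissible_l unfolding admissible_sequences_def Let_def by blast
next
  case False
  \<comment> \<open>What remains is a pure power of \<open>omega\<close>; its reduced sum has
    coefficient 0 and vanishes.\<close>
  then have "ps = []" "m = 1" using assms(1) by (auto simp: cantor_normal_form_def)
  then show ?thesis by (simp add: one_omega1_def[symmetric])
qed

text \<open>The hypothesis says that \<open>l\<close> commutes with adding \<open>b\<close> on the
  left, so the recursions for \<open>S (b + g)\<close> and \<open>S g\<close> run in parallel.
  Conditions on the minimum of a union translate into conditions on the set of minima.\<close>

lemma schreier_plus:
  assumes \<beta>: "\<And>g n. g < w \<Longrightarrow> olimit g \<Longrightarrow> 1 \<le> n \<Longrightarrow> l (b + g) n = b + l g n"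
  shows "g < w \<Longrightarrow> S (b + g) = convolution (S g) (S b)"
proof (induction g rule: less_induct)
  case (less g)
  have fin: "finite A" if "A \<in> S b" for A using that schreier_finite_pos by blast
  show ?case
  proof (cases g rule: omega1_cases)
    case zero
    have "E \<in> convolution (S 0) (S b)" if "E \<in> S b" for E
    proof (cases "E = {}")
      case True
      then show ?thesis by (auto simp: convolution_def separated_def empty_in_schreier intro!: exI[of _ "{}"])
    next
      case False
      then have "1 \<le> Min E" using schreier_finite_pos[OF that] Min_in[of E] by (metis One_nat_def Suc_leI neq0_conv)
      then show ?thesis using that False
        by (auto simp: convolution_def separated_def schreier_zero intro!: exI[of _ "{E}"])
    qed
    moreover have "E \<in> S b" if "E \<in> convolution (S 0) (S b)" for E
    proof -
      obtain X where X: "separated X" "X \<subseteq> S b - {{}}" "E = \<Union>X" "Min ` X \<in> S 0"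
        using \<open>E \<in> _\<close> by (auto simp: convolution_def)
      \<comment> \<open>Membership in \<open>S 0\<close> gives all members of \<open>X\<close> the
        same minimum, which two distinct separated sets cannot have.\<close>
      have "A = B" if AB: "A \<in> X" "B \<in> X" for A B
      proof (rule ccontr)
        assume ne: "A \<noteq> B"
        have "Min A \<in> Min ` X" "Min B \<in> Min ` X" using AB by auto
        moreover obtain n where "Min ` X = {n}" using X(4) AB by (auto simp: schreier_zero)
        ultimately have "Min A = Min B" by simp
        moreover have "Min A \<in> A" "Min B \<in> B" using AB X(2) fin Min_in by blast+
        ultimately show False using X(1) AB ne by (metis less_irrefl separated_def set_less_def)
      qed
      then have "X = {} \<or> (\<exists>A. X = {A})" by blast
      then show ?thesis using X(2,3) empty_in_schreier by auto
    qed
    ultimately show ?thesis using zero by auto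
  next
    case (osuc d)
    have IH: "S (b + d) = convolution (S d) (S b)" using less.IH[of d] less.prems osuc by (meson less_osuc less_trans)
    have "E \<in> S (osuc (b + d)) \<longleftrightarrow> E \<in> convolution (S (osuc d)) (S b)" for E
    proof (cases "E = {}")
      case True
      then show ?thesis
        by (auto simp: empty_in_schreier convolution_def separated_def intro!: exI[of _ "{}"])
    next
      case False
      have "E \<in> convolution (S (osuc d)) (S b) \<longleftrightarrow> E \<in> convolution (blocks (S d) (Min E)) (S b)"
      proof -
        have "Min ` X \<in> S (osuc d) \<longleftrightarrow> Min ` X \<in> blocks (S d) (Min E)"
          if X: "separated X" "X \<subseteq> S b - {{}}" "E = \<Union>X" for X
        proof -
          have "X \<noteq> {}" using X False by auto
          then have "Min (Min ` X) = Min E" using Min_Min_image[of X] X fin by (auto simp: separated_def)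
          with \<open>X \<noteq> {}\<close> show ?thesis by (simp add: schreier_osuc_blocks)
        qed
        then show ?thesis unfolding convolution_def by blast
      qed
      also have "\<dots> \<longleftrightarrow> E \<in> S (osuc (b + d))"
        using False by (simp add: convolution_blocks[OF fin] IH schreier_osuc_blocks)
      finally show ?thesis by blast
    qed
    then show ?thesis using osuc by (auto simp: plus_omega1_osuc)
  next
    case olimit
    have "E \<in> S (b + g) \<longleftrightarrow> E \<in> convolution (S g) (S b)" for E
    proof -
      have "E \<in> S (b + g) \<longleftrightarrow> (\<exists>k\<ge>1. (\<forall>e\<in>E. k \<le> e) \<and> E \<in> S (l (b + g) k))"
        by (simp add: schreier_olimit[OF olimit_plus[OF olimit]])
      also have "\<dots> \<longleftrightarrow> (\<exists>k\<ge>1. (\<forall>e\<in>E. k \<le> e) \<and> E \<in> convolution (S (l g k)) (S b))"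
      proof -
        have "S (l (b + g) k) = convolution (S (l g k)) (S b)" if "1 \<le> k" for k
          using \<beta>[OF less.prems olimit that] less.IH[OF l_less[OF olimit that]]
            l_less[OF olimit that] less.prems by (metis less_trans)
        then show ?thesis by auto
      qed
      also have "\<dots> \<longleftrightarrow> E \<in> convolution (S g) (S b)"
      proof -
        have bound: "(\<forall>e\<in>E. k \<le> e) \<longleftrightarrow> (\<forall>m\<in>Min ` X. k \<le> m)"
          if X: "separated X" "X \<subseteq> S b - {{}}" "E = \<Union>X" for X k
        proof -
          have "(\<forall>e\<in>A. k \<le> e) \<longleftrightarrow> k \<le> Min A" if "A \<in> X" for A
            using that X(2) fin by (subst Min_ge_iff) auto
          then show ?thesis using X(3) by auto
        qed
        show ?thesis
        proof
          assume "\<exists>k\<ge>1. (\<forall>e\<in>E. k \<le> e) \<and> E \<in> convolution (S (l g k)) (S b)"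
          then obtain k where k: "1 \<le> k" "\<forall>e\<in>E. k \<le> e" and "E \<in> convolution (S (l g k)) (S b)"
            by blast
          then obtain X where X: "separated X" "X \<subseteq> S b - {{}}" "E = \<Union>X" "Min ` X \<in> S (l g k)"
            unfolding convolution_def by blast
          have "\<forall>m\<in>Min ` X. k \<le> m" using bound[OF X(1-3)] k(2) by (rule iffD1)
          then have "Min ` X \<in> S g" unfolding schreier_olimit[OF olimit] using k(1) X(4) by blast
          with X show "E \<in> convolution (S g) (S b)" unfolding convolution_def by blast
        next
          assume "E \<in> convolution (S g) (S b)"
          then obtain X where X: "separated X" "X \<subseteq> S b - {{}}" "E = \<Union>X" "Min ` X \<in> S g"
            unfolding convolution_def by blast
          then obtain k where k: "1 \<le> k" "\<forall>m\<in>Min ` X. k \<le> m" "Min ` X \<in> S (l g k)"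
            unfolding schreier_olimit[OF olimit] by blast
          have "E \<in> convolution (S (l g k)) (S b)" unfolding convolution_def using X(1-3) k(3) by blast
          then show "\<exists>k\<ge>1. (\<forall>e\<in>E. k \<le> e) \<and> E \<in> convolution (S (l g k)) (S b)"
            using k bound[OF X(1-3)] by blast
        qed
      qed
      finally show ?thesis .
    qed
    then show ?thesis by blast
  qed
qed

text \<open>Split one copy of the last power off: \<open>a = b + omega_pow x\<close>. Then
  \<open>S (l a n)\<close> is the convolution of \<open>S (l (omega_pow x) n)\<close> with
  \<open>S b\<close>, and condition (3) for \<open>omega_pow x\<close> carries over.\<close>

lemma schreier_olimit_increasing:
  assumes a: "olimit a" and n: "1 \<le> n"
  shows "S (l a n) \<subseteq> S (l a (n + 1))"
proof -
  obtain ps x m where ps: "cantor_normal_form (ps @ [(x, m)])" "a = cnf_sum (ps @ [(x, m)])" "1 \<le> m"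
    using olimit_cantor_normal_form[OF a] .
  define b where "b = cnf_sum (ps @ [(x, m - 1)])"
  have la: "l a n = b + l (omega_pow x) n" if "1 \<le> n" for n
    using l_cnf_sum[OF ps(1)] a ps(2) that unfolding b_def by simp
  have ab: "a = b + omega_pow x"
  proof -
    obtain k where k: "m = Suc k" using ps(3) by (cases m) auto
    show ?thesis unfolding b_def ps(2) k by (simp add: cnf_sum_append times_omega1_osuc plus_assoc_omega1)
  qed
  have ox: "olimit (omega_pow x)"
  proof (cases "omega_pow x" rule: omega1_cases)
    case zero
    then show ?thesis using omega_pow_pos[of x] by simp
  next
    case (osuc c)
    then have "a = osuc (b + c)" using ab by (simp add: plus_omega1_osuc)
    then show ?thesis using a by (auto simp: olimit_def)
  qed
  \<comment> \<open>A term with coefficient 0 would violate normality and is dropped.\<close>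
  define qs where "qs = ps @ (if m = 1 then [] else [(x, m - 1)])"
  have qs: "cantor_normal_form qs" "\<forall>q\<in>set qs. x \<le> fst q" "cnf_sum qs = b"
    using ps(1,3) by (auto simp: qs_def b_def cantor_normal_form_def sorted_wrt_append cnf_sum_append)
  \<comment> \<open>All exponents of \<open>g\<close> are below \<open>x\<close>, so the normal
    forms of \<open>b\<close> and \<open>g\<close> concatenate, and condition (1) alters only their
    common last term.\<close>
  have shift: "l (b + g) k = b + l g k" if g: "g < omega_pow x" "olimit g" "1 \<le> k" for g k
  proof -
    obtain rs z j where rs: "cantor_normal_form (rs @ [(z, j)])" "g = cnf_sum (rs @ [(z, j)])" "1 \<le> j"
      using olimit_cantor_normal_form[OF g(2)] .
    have less: "fst q < x" if "q \<in> set (rs @ [(z, j)])" for q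
      using omega_pow_le_cnf_sum[OF rs(1) that] g(1) rs(2) by (metis le_less_trans omega_pow_less_iff)
    have "cantor_normal_form ((qs @ rs) @ [(z, j)])"
    proof -
      have "fst q < fst p" if "p \<in> set qs" "q \<in> set (rs @ [(z, j)])" for p q
        using qs(2) less that by (meson less_le_trans)
      then show ?thesis using qs(1) rs(1) unfolding cantor_normal_form_def append_assoc
        by (subst sorted_wrt_append) auto
    qed
    moreover have bg: "b + g = cnf_sum ((qs @ rs) @ [(z, j)])"
      using qs(3) rs(2) by (simp add: cnf_sum_append plus_assoc_omega1)
    ultimately have "l (b + g) k = cnf_sum ((qs @ rs) @ [(z, j - 1)]) + l (omega_pow z) k"
      using l_cnf_sum[of "qs @ rs" z j k] olimit_plus[OF g(2), of b] g(3) by simp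
    also have "\<dots> = b + l g k"
      using l_cnf_sum[OF rs(1), of k] rs(2) g(2,3) qs(3) by (simp add: cnf_sum_append plus_assoc_omega1)
    finally show ?thesis .
  qed
  have "S (l a k) = convolution (S (l (omega_pow x) k)) (S b)" if "1 \<le> k" for k
    using schreier_plus[OF shift l_less[OF ox that]] la[OF that] by simp
  then show ?thesis using convolution_mono[OF increasing_pure_power[OF ox n]] n by simp
qed

text \<open>Membership at a limit supplies only some \<open>k \<le> Min B\<close>; monotonicity
  raises it to \<open>Min B\<close>. Extensions keep the minimum, so one inside
  \<open>S (l a (Min B))\<close> would also lie in \<open>S a\<close>.\<close>

lemma prec_maximal_olimit:
  assumes a: "olimit a" and B: "B \<in> prec_maximal (S a)"
  shows "B \<in> prec_maximal (S (l a (Min B)))" "1 \<le> Min B"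
proof -
  have BS: "B \<in> S a" and ne: "B \<noteq> {}" using B prec_maximal_nonempty by (auto simp: prec_maximal_def)
  have fin: "finite B" "0 \<notin> B" using schreier_finite_pos[OF BS] by auto
  then show M: "1 \<le> Min B" using Min_in[of B] ne by (metis One_nat_def Suc_leI neq0_conv)
  obtain k where k: "1 \<le> k" "\<forall>e\<in>B. k \<le> e" "B \<in> S (l a k)"
    using BS a by (auto simp: schreier_olimit)
  have "k \<le> Min B" using k fin ne by simp
  then have "S (l a k) \<subseteq> S (l a (Min B))"
  proof (induction rule: dec_induct)
    case (step n)
    then show ?case using schreier_olimit_increasing[OF a, of n] k(1) by simp
  qed simp
  with k have "B \<in> S (l a (Min B))" by blast
  moreover have "\<not> proper_init_seg B C" if C: "C \<in> S (l a (Min B))" for C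
  proof
    assume BC: "proper_init_seg B C"
    then have "Min B = Min C"
      using init_seg_Min[of B C] ne schreier_finite_pos[OF C] by (auto simp: proper_init_seg_def)
    then have "C \<in> S a" using schreier_finite_pos[OF C] C a M by (auto simp: schreier_olimit)
    then show False using B BC by (auto simp: prec_maximal_def)
  qed
  ultimately show "B \<in> prec_maximal (S (l a (Min B)))" by (auto simp: prec_maximal_def)
qed

text \<open>Each block is taken as the longest initial segment in \<open>S g\<close>. It contains
  the first block of any given splitting, so the rest still needs at most \<open>n\<close> blocks.
  If something remains, the block is maximal, since otherwise the next point could be added. Only
  the last block may fail to be maximal, hence \<open>butlast\<close>.\<close>

lemma greedy_decomposition:
  assumes "B \<in> blocks (S g) n"
  shows "\<exists>As. (\<forall>A\<in>set As. A \<noteq> {} \<and> A \<in> S g) \<and> sorted_wrt set_less As \<and> length As \<le> n \<and>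
    \<Union>(set As) = B \<and> (\<forall>A\<in>set (butlast As). A \<in> prec_maximal (S g))"
  using assms
proof (induction n arbitrary: B)
  case 0
  then show ?case by (intro exI[of _ "[]"]) auto
next
  case (Suc n)
  show ?case
  proof (cases "B = {}")
    case True
    then show ?thesis by (intro exI[of _ "[]"]) auto
  next
    case ne: False
    obtain A1 B1 where B: "B = A1 \<union> B1" "A1 \<in> S g" "B1 \<in> blocks (S g) n" "set_less A1 B1"
      using Suc.prems by auto
    have fin: "finite B" and "0 \<notin> B" using blocks_schreier_finite_pos[OF Suc.prems] by auto
    then have pos: "1 \<le> b" if "b \<in> B" for b using that by (metis One_nat_def Suc_leI neq0_conv)
    define I where "I = {D. init_seg D B \<and> D \<in> S g}"
    have "finite I" by (rule finite_subset[of _ "Pow B"]) (auto simp: I_def init_seg_def fin)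
    have "{} \<in> I" by (simp add: I_def empty_in_schreier)
    then have "Max (card ` I) \<in> card ` I" using \<open>finite I\<close> by (intro Max_in) auto
    then obtain D where "D \<in> I" and cD: "card D = Max (card ` I)" by fastforce
    then have D: "D \<in> I" "\<And>D'. D' \<in> I \<Longrightarrow> card D' \<le> card D"
      using \<open>finite I\<close> by simp_all
    have Di: "init_seg D B" "D \<in> S g" using D(1) by (auto simp: I_def)
    then have finD: "finite D" using schreier_finite_pos by blast
    have next_notin: "insert q D \<notin> S g" if q: "q = Min (B - D)" "B - D \<noteq> {}" for q
    proof
      assume "insert q D \<in> S g"
      have "q \<in> B - D" using q fin Min_in[of "B - D"] by simp
      moreover have "q \<le> b" if "b \<in> B - D" for b using that q fin by simp
      ultimately have "init_seg (insert q D) B"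
        using Di(1) unfolding init_seg_def by (auto simp: order.order_iff_strict)
      with \<open>insert q D \<in> S g\<close> have "card (insert q D) \<le> card D" using D(2) by (simp add: I_def)
      with \<open>q \<in> B - D\<close> finD show False by simp
    qed
    have "A1 \<subseteq> D"
    proof -
      have "init_seg A1 B" using B(1,4) by (auto simp: init_seg_def set_less_def)
      then have "A1 \<in> I" using B(2) by (simp add: I_def)
      then show ?thesis using D(2)[OF \<open>A1 \<in> I\<close>] init_seg_linear[OF \<open>init_seg A1 B\<close> Di(1)] finD
        by (metis card_seteq init_seg_def schreier_finite_pos B(2) order.refl)
    qed
    then have "B - D \<subseteq> B1" using B(1) by blast
    then have "B - D \<in> blocks (S g) n" using blocks_schreier_hereditary[OF B(3)] by blast
    from Suc.IH[OF this]
    obtain As where As: "\<forall>A\<in>set As. A \<noteq> {} \<and> A \<in> S g" "sorted_wrt set_less As" "length As \<le> n"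
      "\<Union>(set As) = B - D" "\<forall>A\<in>set (butlast As). A \<in> prec_maximal (S g)"
      by (elim exE conjE) (rule that)
    have D_ne: "D \<noteq> {}"
    proof
      assume "D = {}"
      then show False using next_notin[of "Min B"] ne schreier_singleton pos fin by simp
    qed
    have "set_less D A" if "A \<in> set As" for A
      using that As(4) Di(1) by (auto simp: init_seg_def set_less_def)
    moreover have "D \<in> prec_maximal (S g)" if "As \<noteq> []"
    proof (rule ccontr)
      assume nm: "D \<notin> prec_maximal (S g)"
      have BD: "B - D \<noteq> {}" using As(1,4) that by (metis Union_empty_conv last_in_set)
      then have q: "Min (B - D) \<in> B - D" using fin by (intro Min_in) auto
      then have "\<forall>b\<in>D. b < Min (B - D)" using Di(1) by (auto simp: init_seg_def)
      then have "insert (Min (B - D)) D \<in> S g"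
        using not_prec_maximal_insert[OF Di(2) nm] pos q by blast
      with next_notin[OF refl BD] show False by simp
    qed
    moreover have "D \<union> (B - D) = B" using Di(1) by (auto simp: init_seg_def)
    ultimately show ?thesis using As D_ne Di(2) by (intro exI[of _ "D # As"]) auto
  qed
qed

text \<open>For maximal \<open>B\<close> the greedy splitting has no slack: a point \<open>q\<close>
  beyond \<open>B\<close> could otherwise be added as a new block, or appended to a last block that
  is not maximal.\<close>

lemma maximal_decomposition:
  assumes B: "B \<in> prec_maximal (S (osuc g))"
  shows "\<exists>As. (\<forall>A\<in>set As. A \<in> prec_maximal (S g)) \<and> sorted_wrt set_less As \<and>
    length As = Min B \<and> \<Union>(set As) = B"
proof -
  have BS: "B \<in> S (osuc g)" and ne: "B \<noteq> {}" using B prec_maximal_nonempty by (auto simp: prec_maximal_def)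
  have fin: "finite B" using schreier_finite_pos[OF BS] by auto
  have no_ext: "insert q B \<notin> blocks (S g) (Min B)" if q: "\<forall>b\<in>B. b < q" for q
  proof
    assume "insert q B \<in> blocks (S g) (Min B)"
    moreover have "Min (insert q B) = Min B" using init_seg_Min[OF init_seg_insert ne, of q] q fin by simp
    ultimately have "insert q B \<in> S (osuc g)" by (simp add: schreier_osuc_blocks)
    moreover have "proper_init_seg B (insert q B)"
      using q init_seg_insert[of B q] by (auto simp: proper_init_seg_def)
    ultimately show False using B by (auto simp: prec_maximal_def)
  qed
  have "B \<in> blocks (S g) (Min B)" using BS ne by (simp add: schreier_osuc_blocks)
  then obtain As where As: "\<forall>A\<in>set As. A \<noteq> {} \<and> A \<in> S g" "sorted_wrt set_less As" "length As \<le> Min B"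
    "\<Union>(set As) = B" "\<forall>A\<in>set (butlast As). A \<in> prec_maximal (S g)"
    using greedy_decomposition by blast
  define q where "q = Suc (Max B)"
  have q: "\<forall>b\<in>B. b < q" "1 \<le> q" using fin by (auto simp: q_def less_Suc_eq_le)
  have "length As = Min B"
  proof (rule ccontr)
    assume "length As \<noteq> Min B"
    then have len: "length (As @ [{q}]) \<le> Min B" using As(3) by simp
    have "\<Union>(set (As @ [{q}])) \<in> blocks (S g) (length (As @ [{q}]))"
      using As q schreier_singleton by (intro blocks_of_list) (auto simp: sorted_wrt_append set_less_def)
    then have "insert q B \<in> blocks (S g) (Min B)"
      using blocks_mono[OF empty_in_schreier len] As(4) by auto
    then show False using no_ext q by blast
  qed
  moreover have "A \<in> prec_maximal (S g)" if A: "A \<in> set As" for A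
  proof (cases "A \<in> set (butlast As)")
    case False
    have ne_As: "As \<noteq> []" using A by auto
    define Bs where "Bs = butlast As"
    have As_eq: "As = Bs @ [A]" using A False ne_As
      by (metis append_butlast_last_id Bs_def in_set_conv_decomp rotate1.simps(2) set_ConsD set_rotate1)
    show ?thesis
    proof (rule ccontr)
      assume "A \<notin> prec_maximal (S g)"
      moreover have "A \<subseteq> B" using A As(4) by blast
      ultimately have "insert q A \<in> S g" using not_prec_maximal_insert[of A g q] As(1) A q by blast
      then have "\<Union>(set (Bs @ [insert q A])) \<in> blocks (S g) (length (Bs @ [insert q A]))"
        using As(1,2,4) q unfolding As_eq
        by (intro blocks_of_list) (auto simp: sorted_wrt_append set_less_def)
      moreover have "\<Union>(set (Bs @ [insert q A])) = insert q B" using As(4) As_eq by auto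
      moreover have "length (Bs @ [insert q A]) = length As" using As_eq by simp
      ultimately have "insert q B \<in> blocks (S g) (length As)" by metis
      then show False using no_ext q(1) blocks_mono[OF empty_in_schreier As(3)] by blast
    qed
  qed (use As in blast)
  ultimately show ?thesis using As(2,4) by blast
qed

text \<open>The first blocks are initial segments of the same union, hence comparable, and
  maximality makes them equal; remove them and repeat.\<close>

lemma maximal_decomposition_unique:
  assumes "\<forall>A\<in>set As. A \<in> prec_maximal (S g)" "sorted_wrt set_less As"
    "\<forall>A\<in>set Bs. A \<in> prec_maximal (S g)" "sorted_wrt set_less Bs" "\<Union>(set As) = \<Union>(set Bs)"
  shows "As = Bs"
  using assms
proof (induction As arbitrary: Bs)
  case Nil
  then show ?case using prec_maximal_nonempty by (cases Bs) auto
next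
  case (Cons A As)
  then have "A \<in> prec_maximal (S g)" by simp
  then have "A \<noteq> {}" using prec_maximal_nonempty by metis
  then obtain B Cs where Bs: "Bs = B # Cs" using Cons.prems(5) by (cases Bs) auto
  let ?U = "\<Union>(set (A # As))"
  have "init_seg A ?U" using Cons.prems(2) by (auto simp: init_seg_def set_less_def)
  moreover have "init_seg B ?U" using Cons.prems(4,5) Bs by (auto simp: init_seg_def set_less_def)
  ultimately have "init_seg A B \<or> init_seg B A" by (rule init_seg_linear)
  then have AB: "A = B" using Cons.prems(1,3) Bs by (auto simp: prec_maximal_def proper_init_seg_def)
  have "A \<inter> \<Union>(set As) = {}"
    using Cons.prems(2) less_irrefl unfolding sorted_wrt.simps set_less_def by blast
  moreover have "B \<inter> \<Union>(set Cs) = {}"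
    using Cons.prems(4) less_irrefl unfolding Bs sorted_wrt.simps set_less_def by blast
  moreover have "A \<union> \<Union>(set As) = A \<union> \<Union>(set Cs)" using Cons.prems(5) Bs AB by simp
  ultimately have "\<Union>(set As) = \<Union>(set Cs)" using AB by blast
  then have "As = Cs" using Cons.prems Bs Cons.IH[of Cs] by simp
  then show ?case using AB Bs by simp
qed

lemma sorted_wrt_set_less_disjoint:
  "sorted_wrt set_less As \<Longrightarrow> A \<in> set As \<Longrightarrow> B \<in> set As \<Longrightarrow> x \<in> A \<Longrightarrow> x \<in> B \<Longrightarrow> A = B"
  by (induction As) (auto simp: set_less_def)

lemma rep_avg_graph_in: "rep_avg_graph l a A x r \<Longrightarrow> x \<in> A \<and> 0 \<le> r"
  by (induction rule: rep_avg_graph.induct) auto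

text \<open>Gives meaning to the description operator in \<open>rep_avg\<close>. The inductive rule
  at successors quantifies over all splittings, which is harmless by uniqueness.\<close>

lemma rep_avg_graph_ex1: "B \<in> prec_maximal (S a) \<Longrightarrow> x \<in> B \<Longrightarrow> \<exists>!r. rep_avg_graph l a B x r"
proof (induction a arbitrary: B rule: less_induct)
  case (less a)
  show ?case
  proof (cases a rule: omega1_cases)
    case zero
    have "B \<in> S 0" using less.prems zero by (simp add: prec_maximal_def)
    then have B: "B = {x}" using less.prems(2) by (auto simp: schreier_zero)
    have "rep_avg_graph l 0 B x 1" using less.prems zero B by (auto intro: rep_avg_graph.zero)
    moreover have "r = 1" if "rep_avg_graph l 0 B x r" for r
      using that by cases (auto simp: olimit_def)
    ultimately show ?thesis using zero by blast
  next
    case (osuc g)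
    obtain As where As: "\<forall>A\<in>set As. A \<in> prec_maximal (S g)" "sorted_wrt set_less As"
      "length As = Min B" "\<Union>(set As) = B"
      using maximal_decomposition less.prems(1) osuc by blast
    obtain A where A: "A \<in> set As" "x \<in> A" using less.prems(2) As(4) by blast
    obtain r where r: "rep_avg_graph l g A x r" and r_un: "\<And>r'. rep_avg_graph l g A x r' \<Longrightarrow> r' = r"
      using less.IH[of g A] A As(1) osuc by auto
    have "rep_avg_graph l (osuc g) B x (1 / real (Min B) * r)"
      using rep_avg_graph.osuc[of As l g A x r] As A r less.prems(1) osuc by simp
    moreover have "r' = 1 / real (Min B) * r" if "rep_avg_graph l (osuc g) B x r'" for r'
      using that
    proof cases
      case (osuc Cs g' C r'')
      then have g: "g' = g" by simp
      have "Cs = As" using maximal_decomposition_unique[of Cs g As] osuc g As by simp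
      moreover have "x \<in> C" using rep_avg_graph_in osuc by blast
      ultimately have "C = A"
        using sorted_wrt_set_less_disjoint[OF As(2), of C A x] A osuc by simp
      then show ?thesis using osuc g r_un by simp
    qed (auto simp: olimit_def)
    ultimately show ?thesis using osuc by blast
  next
    case olimit
    note m = prec_maximal_olimit[OF olimit less.prems(1)]
    obtain r where r: "rep_avg_graph l (l a (Min B)) B x r"
      "\<And>r'. rep_avg_graph l (l a (Min B)) B x r' \<Longrightarrow> r' = r"
      using less.IH[OF l_less[OF olimit m(2)] m(1) less.prems(2)] by blast
    have "rep_avg_graph l a B x r" using rep_avg_graph.olimit olimit less.prems(1) r(1) by blast
    moreover have "r' = r" if "rep_avg_graph l a B x r'" for r'
      using that by cases (use olimit r(2) in \<open>auto simp: olimit_def\<close>)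
    ultimately show ?thesis by blast
  qed
qed

text \<open>Ranks drop strictly along proper extensions, so an extension of least rank is
  maximal.\<close>

lemma prec_maximal_extension_exists:
  assumes "A \<in> S a"
  shows "\<exists>B\<in>prec_maximal (S a). init_seg A B"
proof -
  obtain \<rho> :: "nat set \<Rightarrow> omega1" where \<rho>: "\<And>A B. A \<in> S a \<Longrightarrow> B \<in> S a \<Longrightarrow> proper_init_seg A B \<Longrightarrow> \<rho> B < \<rho> A"
    using tree_rank_schreier[of a] unfolding tree_rank_le_def by blast
  define P where "P B \<longleftrightarrow> B \<in> S a \<and> init_seg A B" for B
  have "P A" using assms by (simp add: P_def)
  have "\<exists>x. P x \<and> (\<forall>y. P y \<longrightarrow> \<rho> x \<le> \<rho> y)"
    using exists_least_iff[of "\<lambda>r. \<exists>x. P x \<and> \<rho> x = r"] \<open>P A\<close> by (metis not_le)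
  then obtain B where B: "P B" "\<And>y. P y \<Longrightarrow> \<rho> B \<le> \<rho> y" by blast
  have "\<not> proper_init_seg B C" if "C \<in> S a" for C
    using B \<rho>[of B C] that init_seg_trans[of A B C] unfolding P_def proper_init_seg_def
    by (meson not_le)
  then show ?thesis using B(1) by (auto simp: P_def prec_maximal_def)
qed

lemma zeta_nonneg:
  assumes "A \<in> S a"
  shows "0 \<le> zeta l a A"
proof (cases "A = {}")
  case False
  define B where "B = (SOME B. B \<in> prec_maximal (S a) \<and> init_seg A B)"
  have B: "B \<in> prec_maximal (S a)" "init_seg A B"
    using prec_maximal_extension_exists[OF assms] unfolding B_def by (metis (mono_tags, lifting) someI_ex)+
  have "Max A \<in> A" using False schreier_finite_pos[OF assms] by simp
  then have "Max A \<in> B" using B(2) by (auto simp: init_seg_def)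
  from rep_avg_graph_ex1[OF B(1) this]
  have "rep_avg_graph l a B (Max A) (rep_avg l a B (Max A))" unfolding rep_avg_def by (rule theI')
  then show ?thesis using rep_avg_graph_in False unfolding zeta_def B_def by auto
qed (simp add: zeta_def)

end

section \<open>The metric as a path metric\<close>

lemma init_seg_Union:
  assumes "\<And>D. D \<in> X \<Longrightarrow> init_seg D A"
  shows "init_seg (\<Union>X) A"
  unfolding init_seg_def
proof (intro conjI ballI)
  fix a b assume "a \<in> \<Union>X" "b \<in> A - \<Union>X"
  then obtain D where "D \<in> X" "a \<in> D" "b \<in> A - D" by blast
  then show "a < b" using assms by (auto simp: init_seg_def)
qed (use assms in \<open>auto simp: init_seg_def\<close>)

lemma largest_common_init_seg:
  shows "init_seg (largest_common_init_seg A B) A" "init_seg (largest_common_init_seg A B) B"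
    "init_seg D A \<Longrightarrow> init_seg D B \<Longrightarrow> init_seg D (largest_common_init_seg A B)"
proof -
  define C where "C = \<Union>{D. init_seg D A \<and> init_seg D B}"
  let ?P = "\<lambda>C. init_seg C A \<and> init_seg C B \<and> (\<forall>D. init_seg D A \<and> init_seg D B \<longrightarrow> init_seg D C)"
  have CA: "init_seg C A" and "init_seg C B" unfolding C_def by (auto intro: init_seg_Union)
  moreover have "init_seg D C" if D: "init_seg D A" "init_seg D B" for D
  proof -
    have "D \<subseteq> C" using D by (auto simp: C_def)
    moreover have "C - D \<subseteq> A - D" using CA by (auto simp: init_seg_def)
    ultimately show ?thesis using D(1) unfolding init_seg_def by blast
  qed
  ultimately have "?P C" by blast
  moreover have "C' = C" if "?P C'" for C' using that \<open>?P C\<close> init_seg_antisym by blast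
  ultimately have "?P (largest_common_init_seg A B)"
    unfolding largest_common_init_seg_def by (rule theI)
  then show "init_seg (largest_common_init_seg A B) A" "init_seg (largest_common_init_seg A B) B"
    "init_seg D A \<Longrightarrow> init_seg D B \<Longrightarrow> init_seg D (largest_common_init_seg A B)" by blast+
qed

text \<open>An initial segment of \<open>A\<close> goes strictly beyond the largest common one
  exactly when it is not an initial segment of \<open>B\<close>. This eliminates the branching point
  from the formula.\<close>

lemma schreier_dist_eq:
  "schreier_dist l \<alpha> A B =
    (\<Sum>D | init_seg D A \<and> \<not> init_seg D B. zeta l \<alpha> D) + (\<Sum>D | init_seg D B \<and> \<not> init_seg D A. zeta l \<alpha> D)"
proof -
  define C where "C = largest_common_init_seg A B"
  note C = largest_common_init_seg[where A = A and B = B, folded C_def]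
  have "proper_init_seg C D \<longleftrightarrow> \<not> init_seg D B" if "init_seg D A" for D
    unfolding proper_init_seg_iff using C(3)[OF that] init_seg_trans[OF _ C(2), of D]
      init_seg_linear[OF C(1) that] by blast
  then have "{D. proper_init_seg C D \<and> init_seg D A} = {D. init_seg D A \<and> \<not> init_seg D B}" by blast
  moreover have "proper_init_seg C D \<longleftrightarrow> \<not> init_seg D A" if "init_seg D B" for D
    unfolding proper_init_seg_iff using C(3)[OF _ that] init_seg_trans[OF _ C(1), of D]
      init_seg_linear[OF C(2) that] by blast
  then have "{D. proper_init_seg C D \<and> init_seg D B} = {D. init_seg D B \<and> \<not> init_seg D A}" by blast
  ultimately show ?thesis unfolding schreier_dist_def Let_def C_def[symmetric] by simp
qed

section \<open>Trees of functionals\<close>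

lemma norm_blinfun_less_obtain:
  fixes f :: "'a::real_normed_vector \<Rightarrow>\<^sub>L real"
  assumes "b < norm f" "0 \<le> b"
  obtains v where "norm v \<le> 1" "b < f v"
proof -
  have "\<exists>x. b * norm x < norm (f x)"
    using norm_blinfun_bound[OF assms(2), of f] assms(1) by (meson not_le)
  then obtain x where x: "b * norm x < \<bar>f x\<bar>" by auto
  have "x \<noteq> 0" using x by auto
  define v where "v = (sgn (f x) / norm x) *\<^sub>R x"
  have "norm v \<le> 1" using \<open>x \<noteq> 0\<close> by (simp add: v_def sgn_if)
  moreover have "f v = \<bar>f x\<bar> / norm x"
    by (simp add: v_def blinfun.scaleR_right sgn_if abs_if)
  then have "b < f v" using x \<open>x \<noteq> 0\<close> by (simp add: pos_less_divide_eq)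
  ultimately show ?thesis by (rule that)
qed

text \<open>Bolzano-Weierstrass applied successively to finitely many sequences.\<close>

lemma common_convergent_subsequence:
  fixes F :: "(nat \<Rightarrow> real) set"
  assumes "finite F" "\<And>f. f \<in> F \<Longrightarrow> Bseq f"
  shows "\<exists>r. strict_mono (r :: nat \<Rightarrow> nat) \<and> (\<forall>f\<in>F. convergent (f \<circ> r))"
  using assms
proof (induction F)
  case empty
  then show ?case by (intro exI[of _ id]) (auto simp: strict_mono_def)
next
  case (insert g F)
  then obtain r where r: "strict_mono (r :: nat \<Rightarrow> nat)" "\<forall>f\<in>F. convergent (f \<circ> r)" by blast
  obtain s where s: "strict_mono s" "monoseq (\<lambda>n. (g \<circ> r) (s n))" using seq_monosub by blast
  have "Bseq (\<lambda>n. (g \<circ> r) (s n))"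
    using insert.prems[of g] by (auto simp: Bseq_def)
  then have "convergent (g \<circ> (r \<circ> s))"
    using Bseq_monoseq_convergent[OF _ s(2)] by (simp add: comp_def)
  moreover have "convergent (f \<circ> (r \<circ> s))" if "f \<in> F" for f
    using r(2) that convergent_subseq_convergent[OF _ s(1), of "f \<circ> r"] by (simp add: comp_assoc)
  ultimately show ?case using strict_mono_o[OF r(1) s(1)] by (intro exI[of _ "r \<circ> s"]) blast
qed

text \<open>The vector \<open>z\<close> is a difference of almost norming vectors taken along a subsequence on which
  the functionals in \<open>Q\<close> converge; this replaces weak compactness.\<close>

lemma szlenk_derivative_step:
  fixes K :: "('a::real_normed_vector \<Rightarrow>\<^sub>L real) set"
  assumes y: "y \<in> szlenk_derivative \<epsilon> K" and \<epsilon>: "0 < \<epsilon>" and \<eta>: "0 < \<eta>" and P: "finite P" and Q: "finite Q"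
  obtains y' z where "y' \<in> K" "norm z \<le> 1" "\<epsilon> / 4 \<le> (y' - y) z"
    "\<And>p. p \<in> P \<Longrightarrow> \<bar>(y' - y) p\<bar> \<le> \<eta>" "\<And>g. g \<in> Q \<Longrightarrow> \<bar>blinfun_apply g z\<bar> \<le> \<eta>"
proof -
  obtain s where s: "\<And>n. s n \<in> K" "\<And>x. (\<lambda>n. s n x) \<longlonglongrightarrow> y x" "\<And>n. \<epsilon> < norm (s n - y)"
    using y unfolding szlenk_derivative_def limitin_weak_star_iff by blast
  have "\<exists>v. norm v \<le> 1 \<and> \<epsilon> < (s n - y) v" for n
    using norm_blinfun_less_obtain[OF s(3)[of n]] \<epsilon> by (metis less_imp_le)
  then obtain v where v: "\<And>n. norm (v n) \<le> 1" "\<And>n. \<epsilon> < (s n - y) (v n)" by metis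
  have "Bseq (\<lambda>n. blinfun_apply g (v n))" for g
  proof (rule BseqI')
    show "norm (blinfun_apply g (v n)) \<le> norm g" for n
      using norm_blinfun[of g "v n"] v(1)[of n] mult_left_le[of "norm (v n)" "norm g"] by simp
  qed
  then obtain r where r: "strict_mono (r :: nat \<Rightarrow> nat)"
      "\<forall>f\<in>(\<lambda>g n. blinfun_apply g (v n)) ` Q. convergent (f \<circ> r)"
    using common_convergent_subsequence[of "(\<lambda>g n. blinfun_apply g (v n)) ` Q"] Q by blast
  then have "\<exists>L. (\<lambda>n. blinfun_apply g (v (r n))) \<longlonglongrightarrow> L" if "g \<in> Q" for g
    using that by (auto simp: convergent_def comp_def)
  then obtain L where L: "\<And>g. g \<in> Q \<Longrightarrow> (\<lambda>n. blinfun_apply g (v (r n))) \<longlonglongrightarrow> L g" by metis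
  have "\<forall>\<^sub>F n in sequentially. \<forall>g\<in>Q. dist (blinfun_apply g (v (r n))) (L g) < \<eta>"
    using L tendstoD[OF _ \<eta>] by (intro eventually_ball_finite Q) blast
  then obtain N where N: "\<And>n g. N \<le> n \<Longrightarrow> g \<in> Q \<Longrightarrow> dist (blinfun_apply g (v (r n))) (L g) < \<eta>"
    by (auto simp: eventually_sequentially)
  define k where "k = r N"
  \<comment> \<open>With \<open>v k\<close> now fixed, weak-star convergence makes its value under
    \<open>s (r n) - y\<close> less than \<epsilon>/2. Half of \<epsilon> - \<epsilon>/2 is the
    \<epsilon>/4 of the conclusion.\<close>
  define \<delta> where "\<delta> = min \<eta> (\<epsilon> / 2)"
  have \<delta>: "0 < \<delta>" using \<epsilon> \<eta> by (simp add: \<delta>_def)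
  have "\<forall>\<^sub>F n in sequentially. dist (s (r n) x) (y x) < \<delta>" for x
    using LIMSEQ_subseq_LIMSEQ[OF s(2) r(1), of x] tendstoD[OF _ \<delta>] by (simp add: comp_def)
  then have "\<forall>\<^sub>F n in sequentially. \<forall>x\<in>insert (v k) P. dist (s (r n) x) (y x) < \<delta>"
    using P by (intro eventually_ball_finite) auto
  then obtain M where M: "\<And>n x. M \<le> n \<Longrightarrow> x \<in> insert (v k) P \<Longrightarrow> dist (s (r n) x) (y x) < \<delta>"
    by (auto simp: eventually_sequentially)
  \<comment> \<open>Both indices are at least \<open>N\<close>, so each functional in
    \<open>Q\<close> has values within \<eta> of its limit on both vectors; halving the difference
    leaves at most \<eta>.\<close>
  define n where "n = max M N"
  define z where "z = (1/2) *\<^sub>R (v (r n) - v k)"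
  show ?thesis
  proof (rule that[of "s (r n)" z])
    show "s (r n) \<in> K" by (rule s(1))
    have "norm (v (r n) - v k) \<le> 2"
      using norm_triangle_ineq4[of "v (r n)" "v k"] v(1)[of "r n"] v(1)[of k] by simp
    then show "norm z \<le> 1" by (simp add: z_def)
    have "\<bar>(s (r n) - y) (v k)\<bar> < \<epsilon> / 2"
      using M[of n "v k"] by (simp add: n_def blinfun.diff_left dist_real_def \<delta>_def)
    then show "\<epsilon> / 4 \<le> (s (r n) - y) z"
      using v(2)[of "r n"] by (simp add: z_def blinfun.scaleR_right blinfun.diff_right)
    show "\<bar>(s (r n) - y) p\<bar> \<le> \<eta>" if "p \<in> P" for p
      using M[of n p] that by (simp add: n_def blinfun.diff_left dist_real_def \<delta>_def)
    show "\<bar>blinfun_apply g z\<bar> \<le> \<eta>" if "g \<in> Q" for g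
      using N[of n g] N[of N g] that
      by (simp add: n_def k_def z_def blinfun.scaleR_right blinfun.diff_right dist_real_def)
  qed
qed

section \<open>Iterated derivatives of the dual ball\<close>

lemma szlenk_derivative_mono: "K \<subseteq> L \<Longrightarrow> szlenk_derivative \<epsilon> K \<subseteq> szlenk_derivative \<epsilon> L"
  unfolding szlenk_derivative_def by blast

lemma szlenk_derivative_cball:
  "szlenk_derivative \<epsilon> (cball 0 1) \<subseteq> (cball 0 1 :: ('a::real_normed_vector \<Rightarrow>\<^sub>L real) set)"
proof
  fix y :: "'a \<Rightarrow>\<^sub>L real" assume "y \<in> szlenk_derivative \<epsilon> (cball 0 1)"
  then obtain s where s: "\<And>n. norm (s n) \<le> 1" "\<And>x. (\<lambda>n. blinfun_apply (s n) x) \<longlonglongrightarrow> y x"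
    unfolding szlenk_derivative_def limitin_weak_star_iff by auto
  have "norm (y x) \<le> 1 * norm x" for x
  proof (rule tendsto_upperbound[OF tendsto_norm[OF s(2)]])
    have "norm (s n x) \<le> 1 * norm x" for n
      using norm_blinfun[of "s n" x] s(1)[of n] by (meson mult_right_mono norm_ge_zero order_trans)
    then show "\<forall>\<^sub>F n in sequentially. norm (s n x) \<le> 1 * norm x" by simp
  qed simp
  then have "norm y \<le> 1" by (intro norm_blinfun_bound) auto
  then show "y \<in> cball 0 1" by simp
qed

text \<open>A derivative need not be contained in the set it is taken of. The dual ball is weak-star
  sequentially closed, which starts the induction; monotonicity of the derivative propagates the
  inclusion.\<close>

lemma szlenk_derivative_iter_osuc_subset:
  fixes \<epsilon> :: real and a :: omega1
  defines "K \<equiv> szlenk_derivative_iter \<epsilon> (cball 0 1 :: ('a::real_normed_vector \<Rightarrow>\<^sub>L real) set)"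
  shows "K (osuc a) \<subseteq> K a"
proof (induction a rule: less_induct)
  case (less a)
  show ?case
  proof (cases a rule: omega1_cases)
    case zero
    then show ?thesis
      by (simp add: K_def szlenk_derivative_iter_osuc szlenk_derivative_iter_zero szlenk_derivative_cball)
  next
    case (osuc b)
    then show ?thesis using szlenk_derivative_mono[OF less[of b]]
      by (simp add: K_def szlenk_derivative_iter_osuc)
  next
    case olimit
    have "K (osuc a) \<subseteq> K b" if "b < a" for b
    proof -
      have "K a \<subseteq> K b" using that olimit by (auto simp: K_def szlenk_derivative_iter_olimit)
      then have "K (osuc a) \<subseteq> K (osuc b)"
        unfolding K_def szlenk_derivative_iter_osuc by (rule szlenk_derivative_mono)
      then show ?thesis using less[OF that] by blast
    qed
    then show ?thesis unfolding K_def szlenk_derivative_iter_olimit[OF olimit] by blast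
  qed
qed

lemma szlenk_derivative_iter_antimono:
  fixes \<epsilon> :: real and a b :: omega1
  defines "K \<equiv> szlenk_derivative_iter \<epsilon> (cball 0 1 :: ('a::real_normed_vector \<Rightarrow>\<^sub>L real) set)"
  shows "a \<le> b \<Longrightarrow> K b \<subseteq> K a"
proof (induction b rule: less_induct)
  case (less b)
  show ?case
  proof (cases "a = b")
    case False
    then have ab: "a < b" using less.prems by simp
    show ?thesis
    proof (cases b rule: omega1_cases)
      case zero
      then show ?thesis using ab by simp
    next
      case (osuc c)
      then have "a \<le> c" using ab by (metis not_less osuc_le_iff)
      then show ?thesis
        using less.IH[of c] szlenk_derivative_iter_osuc_subset[of \<epsilon> c, where 'a='a] osuc by (auto simp: K_def)
    next
      case olimit
      then show ?thesis using ab by (auto simp: K_def szlenk_derivative_iter_olimit)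
    qed
  qed simp
qed

lemma szlenk_index_greater_imp:
  assumes "top.Value m < szlenk_index TYPE('a::real_normed_vector)"
  shows "\<exists>\<epsilon>>0. szlenk_derivative_iter \<epsilon> (cball 0 1 :: ('a \<Rightarrow>\<^sub>L real) set) m \<noteq> {}"
proof -
  obtain \<epsilon> a where "\<epsilon> > 0" "szlenk_derivative_iter \<epsilon> (cball 0 1 :: ('a \<Rightarrow>\<^sub>L real) set) a \<noteq> {}"
      "top.Value m < top.Value a"
    using assms unfolding szlenk_index_def less_SUP_iff by auto
  then show ?thesis
    using szlenk_derivative_iter_antimono[of m a \<epsilon>, where 'a='a] by (auto intro!: exI[of _ \<epsilon>])
qed

section \<open>Choosing functionals and vectors along the tree\<close>

lemma set_encode_remove_less:
  assumes "finite A" "a \<in> A"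
  shows "set_encode (A - {a}) < set_encode A"
  using assms by (simp add: set_encode_def sum.remove)

lemma set_encode_mono: "finite B \<Longrightarrow> A \<subseteq> B \<Longrightarrow> set_encode A \<le> set_encode B"
  by (simp add: set_encode_def sum_mono2)

lemma init_seg_remove_Max: "finite D \<Longrightarrow> D \<noteq> {} \<Longrightarrow> init_seg (D - {Max D}) D"
  unfolding init_seg_def by (auto simp: less_le)

lemma init_seg_remove_MaxI:
  assumes "finite D" "init_seg E D" "E \<noteq> D"
  shows "init_seg E (D - {Max D})"
proof -
  obtain b where b: "b \<in> D - E" using assms(2,3) by (auto simp: init_seg_def)
  have "Max D \<notin> E"
  proof
    assume "Max D \<in> E"
    then have "Max D < b" using assms(2) b by (auto simp: init_seg_def)
    then show False using Max_ge[OF assms(1), of b] b by simp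
  qed
  then show ?thesis using assms(2) by (auto simp: init_seg_def)
qed

text \<open>Going from a node to a successor lowers the rank and so permits one derivative.
  Telescoping the increments along a branch then gives the values of \<open>y D\<close> on every
  \<open>z E\<close>. The set \<open>H\<close> is the pool from which the final functionals come:
  the dual ball itself, or the evaluations at points of the ball of a predual.\<close>

lemma szlenk_tree:
  fixes S :: "nat set set" and H :: "('a::real_normed_vector \<Rightarrow>\<^sub>L real) set" and m :: omega1
  assumes fin: "\<And>A. A \<in> S \<Longrightarrow> finite A" and init: "\<And>A B. A \<in> S \<Longrightarrow> init_seg B A \<Longrightarrow> B \<in> S"
    and rank: "tree_rank_le S m"
    and \<epsilon>: "0 < \<epsilon>" and ne: "szlenk_derivative_iter \<epsilon> (cball 0 1 :: ('a \<Rightarrow>\<^sub>L real) set) m \<noteq> {}"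
    and H: "\<And>y P \<eta>. norm y \<le> 1 \<Longrightarrow> finite P \<Longrightarrow> 0 < \<eta> \<Longrightarrow> \<exists>h\<in>H. \<forall>p\<in>P. \<bar>blinfun_apply h p - blinfun_apply y p\<bar> \<le> \<eta>"
  shows "\<exists>h z c. 0 < c \<and> (\<forall>A\<in>S. h A \<in> H \<and> norm (z A) \<le> 1) \<and>
    (\<forall>D\<in>S. \<forall>E\<in>S. E \<noteq> {} \<longrightarrow> (if init_seg E D then 3 * c \<le> blinfun_apply (h D) (z E)
       else \<bar>blinfun_apply (h D) (z E)\<bar> \<le> c))"
proof -
  define K where "K = szlenk_derivative_iter \<epsilon> (cball 0 1 :: ('a \<Rightarrow>\<^sub>L real) set)"
  obtain \<rho> where \<rho>: "\<And>A. A \<in> S \<Longrightarrow> \<rho> A \<le> m"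
    "\<And>A B. A \<in> S \<Longrightarrow> B \<in> S \<Longrightarrow> proper_init_seg A B \<Longrightarrow> \<rho> B < \<rho> A"
    using rank unfolding tree_rank_le_def by blast
  have K_mono: "K b \<subseteq> K a" if "a \<le> b" for a b
    unfolding K_def by (rule szlenk_derivative_iter_antimono[OF that])
  have K_norm: "norm y \<le> 1" if "y \<in> K a" for y a
    using that K_mono[of 0 a] by (auto simp: K_def szlenk_derivative_iter_zero)
  \<comment> \<open>The lower bound supplied by \<open>szlenk_derivative_step\<close>.\<close>
  define c where "c = \<epsilon> / 4"
  have c: "0 < c" using \<epsilon> by (simp add: c_def)
  define pred where "pred A = A - {Max A}" for A :: "nat set"
  \<comment> \<open>The triple at code \<open>n\<close> consists of the functional, the vector and
    the substitute from \<open>H\<close>. Code 0 is the empty set, which has no predecessor; codes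
    outside the tree are unconstrained. The factor \<open>(1/2)^n\<close> makes the errors along a
    branch summable.\<close>
  define R where "R f n t \<longleftrightarrow> (set_decode n \<in> S \<longrightarrow>
     (case t of (y, z, h) \<Rightarrow> y \<in> K (\<rho> (set_decode n)) \<and> norm z \<le> 1 \<and> h \<in> H \<and>
      (n \<noteq> 0 \<longrightarrow> (let u = y - fst (f (set_encode (pred (set_decode n)))) in
        c \<le> blinfun_apply u z \<and>
        (\<forall>k<n. \<bar>blinfun_apply u (fst (snd (f k)))\<bar> \<le> c / 16 * (1/2)^n \<and>
           \<bar>blinfun_apply (fst (f k)) z\<bar> \<le> c / 16 \<and> \<bar>blinfun_apply (snd (snd (f k))) z\<bar> \<le> c / 16))) \<and>
      (\<forall>k<n. \<bar>blinfun_apply h (fst (snd (f k))) - blinfun_apply y (fst (snd (f k)))\<bar> \<le> c / 16) \<and>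
      \<bar>blinfun_apply h z - blinfun_apply y z\<bar> \<le> c / 16))"
    for f :: "nat \<Rightarrow> ('a \<Rightarrow>\<^sub>L real) \<times> 'a \<times> ('a \<Rightarrow>\<^sub>L real)" and n t
  have pred_less: "set_encode (pred (set_decode n)) < n" if "n \<noteq> 0" for n
  proof -
    have "set_decode n \<noteq> {}" using that by (metis set_decode_inverse set_encode_empty)
    then have "set_encode (pred (set_decode n)) < set_encode (set_decode n)"
      unfolding pred_def by (intro set_encode_remove_less) auto
    then show ?thesis by simp
  qed
  \<comment> \<open>The recursion is legitimate because the predecessor of a nonempty set has a
    smaller code.\<close>
  have "\<exists>f. \<forall>n. R f n (f n)"
  proof (rule dependent_wellorder_choice)
    show "R f n t = R g n t" if "\<And>k. k < n \<Longrightarrow> f k = g k" for t f g n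
      using that pred_less[of n] unfolding R_def by (cases "n = 0") auto
  next
    fix n f assume IH: "\<And>k. k < n \<Longrightarrow> R f k (f k)"
    show "\<exists>t. R f n t"
    proof (cases "set_decode n \<in> S")
      case A: True
      define A where "A = set_decode n"
      define Z where "Z = (\<lambda>k. fst (snd (f k))) ` {..<n}"
      have Z: "finite Z" "\<And>k. k < n \<Longrightarrow> fst (snd (f k)) \<in> Z" by (auto simp: Z_def)
      show ?thesis
      proof (cases "n = 0")
        case True
        \<comment> \<open>The root may take any element of \<open>K m\<close>; its vector is 0,
          since the conclusion concerns only nonempty \<open>E\<close>.\<close>
        obtain y where y: "y \<in> K m" using ne by (auto simp: K_def)
        then have yK: "y \<in> K (\<rho> A)" using K_mono \<rho>(1) A unfolding A_def by blast
        obtain h where h: "h \<in> H" "\<forall>p\<in>{0}. \<bar>blinfun_apply h p - blinfun_apply y p\<bar> \<le> c / 16"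
          using H[OF K_norm[OF y], of "{0}" "c / 16"] c by auto
        then have "R f n (y, 0, h)" using True yK c by (simp add: R_def A_def)
        then show ?thesis by blast
      next
        case False
        have "A \<noteq> {}" using False unfolding A_def by (metis set_decode_inverse set_encode_empty)
        have "finite A" by (simp add: A_def)
        have "init_seg (pred A) A"
          unfolding pred_def using \<open>finite A\<close> \<open>A \<noteq> {}\<close> by (rule init_seg_remove_Max)
        moreover have "Max A \<in> A" using \<open>finite A\<close> \<open>A \<noteq> {}\<close> by (rule Max_in)
        then have "pred A \<noteq> A" unfolding pred_def by blast
        ultimately have pA: "init_seg (pred A) A" "pred A \<noteq> A" .
        define q where "q = set_encode (pred A)"
        have q: "q < n" "set_decode q = pred A"
          using pred_less[OF False] \<open>finite A\<close> by (auto simp: q_def A_def pred_def)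
        have pS: "pred A \<in> S" using init A pA unfolding A_def by blast
        define y where "y = fst (f q)"
        have "y \<in> K (\<rho> (pred A))"
          using IH[OF q(1)] pS q(2) by (cases "f q") (simp add: R_def y_def)
        \<comment> \<open>The strict drop of rank places the predecessor's functional in the
          derivative of \<open>K (\<rho> A)\<close>.\<close>
        moreover have "osuc (\<rho> A) \<le> \<rho> (pred A)"
          using \<rho>(2)[OF pS, of A] A pA by (simp add: A_def proper_init_seg_def osuc_le_iff)
        ultimately have "y \<in> K (osuc (\<rho> A))" using K_mono by blast
        then have y_der: "y \<in> szlenk_derivative \<epsilon> (K (\<rho> A))"
          by (simp add: K_def szlenk_derivative_iter_osuc)
        define Q where "Q = (\<lambda>k. fst (f k)) ` {..<n} \<union> (\<lambda>k. snd (snd (f k))) ` {..<n}"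
        have Q: "finite Q" "\<And>k. k < n \<Longrightarrow> fst (f k) \<in> Q" "\<And>k. k < n \<Longrightarrow> snd (snd (f k)) \<in> Q"
          by (auto simp: Q_def)
        define \<eta> where "\<eta> = c / 16 * (1/2)^n"
        have \<eta>: "0 < \<eta>" "\<eta> \<le> c / 16"
          using c power_le_one[of "1/2::real" n] by (auto simp: \<eta>_def)
        obtain y' z where y': "y' \<in> K (\<rho> A)" "norm z \<le> 1" "\<epsilon> / 4 \<le> (y' - y) z"
            "\<And>p. p \<in> Z \<Longrightarrow> \<bar>(y' - y) p\<bar> \<le> \<eta>" "\<And>g. g \<in> Q \<Longrightarrow> \<bar>blinfun_apply g z\<bar> \<le> \<eta>"
          using szlenk_derivative_step[OF y_der \<epsilon> \<eta>(1) Z(1) Q(1)] by blast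
        obtain h where h: "h \<in> H" "\<And>p. p \<in> insert z Z \<Longrightarrow> \<bar>blinfun_apply h p - blinfun_apply y' p\<bar> \<le> c / 16"
          using H[OF K_norm[OF y'(1)], of "insert z Z" "c / 16"] c Z(1) by auto
        have "\<bar>blinfun_apply g z\<bar> \<le> c / 16" if "g \<in> Q" for g
          using y'(5)[OF that] \<eta>(2) by simp
        then have "R f n (y', z, h)"
          unfolding R_def Let_def prod.case A_def[symmetric] q_def[symmetric] y_def[symmetric]
          using y' h Z(2) Q(2,3) by (auto simp: \<eta>_def c_def)
        then show ?thesis by blast
      qed
    qed (simp add: R_def)
  qed
  then obtain f where f: "\<And>n. R f n (f n)" by blast
  define y where "y A = fst (f (set_encode A))" for A
  define z where "z A = fst (snd (f (set_encode A)))" for A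
  define h where "h A = snd (snd (f (set_encode A)))" for A
  define \<kappa> where "\<kappa> = (set_encode :: nat set \<Rightarrow> nat)"
  have fA: "y A \<in> K (\<rho> A) \<and> norm (z A) \<le> 1 \<and> h A \<in> H \<and>
      (A \<noteq> {} \<longrightarrow> c \<le> (y A - y (pred A)) (z A) \<and>
        (\<forall>B\<in>S. \<kappa> B < \<kappa> A \<longrightarrow> \<bar>(y A - y (pred A)) (z B)\<bar> \<le> c / 16 * (1/2)^\<kappa> A \<and>
          \<bar>y B (z A)\<bar> \<le> c / 16 \<and> \<bar>h B (z A)\<bar> \<le> c / 16)) \<and>
      (\<forall>B\<in>S. \<kappa> B < \<kappa> A \<longrightarrow> \<bar>h A (z B) - y A (z B)\<bar> \<le> c / 16) \<and> \<bar>h A (z A) - y A (z A)\<bar> \<le> c / 16"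
    if "A \<in> S" for A
  proof -
    have dec: "set_decode (set_encode A) = A" using fin[OF that] by simp
    have "set_encode A \<noteq> 0" if "A \<noteq> {}" using that dec by auto
    then show ?thesis
      using f[of "set_encode A"] that
      unfolding R_def dec Let_def y_def z_def h_def \<kappa>_def by (cases "f (set_encode A)") auto
  qed
  have \<kappa>_inj: "A = B" if "A \<in> S" "B \<in> S" "\<kappa> A = \<kappa> B" for A B
    using that fin unfolding \<kappa>_def by (metis set_encode_inverse)
  have pred_D: "pred D \<in> S" "init_seg (pred D) D" "\<kappa> (pred D) < \<kappa> D" if "D \<in> S" "D \<noteq> {}" for D
    using that fin init init_seg_remove_Max[of D] set_encode_remove_less[of D "Max D"]
    by (auto simp: pred_def \<kappa>_def)
  \<comment> \<open>The factor \<open>2 - (1/2)^\<kappa> D\<close> closes the induction: the base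
    costs c/16, and since \<open>\<kappa> (pred D) < \<kappa> D\<close>, the factor grows by at
    least \<open>(1/2)^\<kappa> D\<close>, which pays for the new increment. For \<open>E\<close>
    coded after \<open>D\<close>, the smallness was imposed when \<open>z E\<close> was
    chosen.\<close>
  have est: "if init_seg E D then c - c / 16 * (2 - (1/2)^\<kappa> D) \<le> y D (z E)
      else \<bar>y D (z E)\<bar> \<le> c / 16 * (2 - (1/2)^\<kappa> D)"
    if E: "E \<in> S" "E \<noteq> {}" and "D \<in> S" for D E
    using \<open>D \<in> S\<close>
  proof (induction "\<kappa> D" arbitrary: D rule: less_induct)
    case less
    have one_le: "c / 16 \<le> c / 16 * (2 - (1/2)^k)" for k :: nat
      using c power_le_one[of "1/2::real" k] by simp
    consider "\<kappa> D < \<kappa> E" | "D = E" | "\<kappa> E < \<kappa> D" using \<kappa>_inj[OF less.prems E(1)] by linarith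
    then show ?case
    proof cases
      case 1
      then have "\<not> init_seg E D"
        using set_encode_mono[of D E] fin[OF less.prems] by (auto simp: \<kappa>_def init_seg_def)
      moreover have "\<bar>y D (z E)\<bar> \<le> c / 16" using fA[OF E(1)] E(2) less.prems 1 by blast
      ultimately show ?thesis using one_le[of "\<kappa> D"] by simp
    next
      case 2
      have "\<bar>y (pred E) (z E)\<bar> \<le> c / 16"
        using fA[OF E(1)] E(2) pred_D[OF E] by blast
      moreover have "c \<le> (y E - y (pred E)) (z E)" using fA[OF E(1)] E(2) by blast
      ultimately show ?thesis using one_le[of "\<kappa> D"] 2 by (simp add: blinfun.diff_left)
    next
      case 3
      then have D: "D \<noteq> {}" by (auto simp: \<kappa>_def)
      note pD = pred_D[OF less.prems D]
      have "init_seg E D \<longleftrightarrow> init_seg E (pred D)"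
        using init_seg_remove_MaxI[OF fin[OF less.prems], of E] init_seg_trans[OF _ pD(2), of E] 3
        unfolding pred_def by auto
      moreover note less.hyps[OF pD(3,1)]
      moreover have "\<bar>(y D - y (pred D)) (z E)\<bar> \<le> c / 16 * (1/2)^\<kappa> D"
        using fA[OF less.prems] D E(1) 3 by blast
      moreover have "2 * (c / 16 * (1/2)^\<kappa> D) \<le> c / 16 * (1/2)^\<kappa> (pred D)"
        using power_decreasing[of "Suc (\<kappa> (pred D))" "\<kappa> D" "1/2::real"] pD(3) c by simp
      moreover have "c / 16 * (2 - (1/2)^k) = c / 8 - c / 16 * (1/2)^k" for k :: nat
        by (simp add: algebra_simps)
      ultimately show ?thesis unfolding blinfun.diff_left by (smt (verit, best))
    qed
  qed
  \<comment> \<open>If \<open>E\<close> is coded later, \<open>z E\<close> was made small on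
    \<open>h D\<close> directly. Otherwise the errors c/8 and c/16 add up to 3c/16, leaving values
    of at least 13c/16 against at most 3c/16; both fit the threshold c/4.\<close>
  have "if init_seg E D then 3 * (c / 4) \<le> h D (z E) else \<bar>h D (z E)\<bar> \<le> c / 4"
    if "D \<in> S" "E \<in> S" "E \<noteq> {}" for D E
  proof (cases "\<kappa> D < \<kappa> E")
    case True
    then have "\<not> init_seg E D"
      using set_encode_mono[of D E] fin[OF that(1)] by (auto simp: \<kappa>_def init_seg_def)
    moreover have "\<bar>h D (z E)\<bar> \<le> c / 16" using fA[OF that(2)] that True by blast
    ultimately show ?thesis using c by simp
  next
    case False
    then have "D = E \<or> \<kappa> E < \<kappa> D" using \<kappa>_inj[OF that(1,2)] by linarith
    then have hy: "\<bar>h D (z E) - y D (z E)\<bar> \<le> c / 16" using fA[OF that(1)] that(2) by blast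
    define e where "e = c / 16 * (2 - (1/2)^\<kappa> D)"
    have "e \<le> c / 8" using c by (simp add: e_def)
    with hy est[OF that(2,3,1), folded e_def] c show ?thesis
      unfolding abs_le_iff by (cases "init_seg E D"; simp only: if_True if_False; linarith)
  qed
  moreover have "0 < c / 4" using c by simp
  ultimately show ?thesis using fA by (intro exI[of _ h] exI[of _ z] exI[of _ "c / 4"] conjI ballI impI) blast+
qed

section \<open>Embeddings\<close>

lemma sum_square_error_along_line:
  fixes P :: "('a::real_normed_vector \<Rightarrow>\<^sub>L real) set" and a :: "_ \<Rightarrow> real"
  shows "(\<Sum>p\<in>P. (a p - blinfun_apply p (w + t *\<^sub>R u))\<^sup>2) = (\<Sum>p\<in>P. (a p - blinfun_apply p w)\<^sup>2) -
    2 * t * (\<Sum>p\<in>P. (a p - blinfun_apply p w) * blinfun_apply p u) + t\<^sup>2 * (\<Sum>p\<in>P. (blinfun_apply p u)\<^sup>2)"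
  unfolding sum_distrib_left sum_subtractf[symmetric] sum.distrib[symmetric]
  by (rule sum.cong) (simp_all add: blinfun.add_right blinfun.scaleR_right power2_eq_square algebra_simps)

text \<open>A form of Goldstine's theorem. An approximate minimiser \<open>w\<^sub>0\<close> of the squared error over the
  unit ball almost norms the functional \<open>G = \<Sum>p\<in>P. (y p - p w\<^sub>0) p\<close>, and
  \<open>y G - G w\<^sub>0\<close> is the squared error at \<open>w\<^sub>0\<close>.\<close>

lemma bidual_ball_approximation:
  fixes y :: "('a::real_normed_vector \<Rightarrow>\<^sub>L real) \<Rightarrow>\<^sub>L real"
  assumes y: "norm y \<le> 1" and P: "finite P" and \<eta>: "0 < \<eta>"
  shows "\<exists>w. norm w \<le> 1 \<and> (\<forall>p\<in>P. \<bar>blinfun_apply p w - blinfun_apply y p\<bar> \<le> \<eta>)"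
proof -
  define q where "q w = (\<Sum>p\<in>P. (y p - blinfun_apply p w)\<^sup>2)" for w
  define M where "M = (\<Sum>p\<in>P. (2 * norm p)\<^sup>2)"
  define \<sigma> where "\<sigma> = \<eta>\<^sup>2"
  \<comment> \<open>A step length for moving from the approximate minimiser towards another point of
    the ball; it keeps the quadratic error \<open>t * M\<close> below \<sigma>.\<close>
  define t where "t = min 1 (\<sigma> / (M + 1))"
  have M: "0 \<le> M" unfolding M_def by (intro sum_nonneg) simp
  have \<sigma>: "0 < \<sigma>" using \<eta> by (simp add: \<sigma>_def)
  have t: "0 < t" "t \<le> 1" using M \<sigma> by (simp_all add: t_def)
  have tM: "t * M \<le> \<sigma>"
  proof -
    have "t * M \<le> \<sigma> / (M + 1) * (M + 1)" using M \<sigma> by (intro mult_mono) (auto simp: t_def)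
    then show ?thesis using M by simp
  qed
  have bdd: "bdd_below (q ` cball 0 1)"
    by (rule bdd_belowI[of _ 0]) (auto simp: q_def intro: sum_nonneg)
  \<comment> \<open>The infimum need not be attained. The slack is proportional to \<open>t\<close>,
    so that it contributes only \<sigma> after division by the step length.\<close>
  have "Inf (q ` cball 0 1) < Inf (q ` cball 0 1) + \<sigma> * t" using \<sigma> t by simp
  from cInf_lessD[OF _ this] have "\<exists>r\<in>q ` cball 0 1. r < Inf (q ` cball 0 1) + \<sigma> * t" by simp
  then obtain w0 where w0: "norm w0 \<le> 1" "q w0 < Inf (q ` cball 0 1) + \<sigma> * t" by auto
  have min: "q w0 \<le> q w + \<sigma> * t" if "norm w \<le> 1" for w
    using cInf_lower[OF _ bdd, of "q w"] that w0(2) by auto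
  define G where "G = (\<Sum>p\<in>P. (y p - blinfun_apply p w0) *\<^sub>R p)"
  have G: "G w = (\<Sum>p\<in>P. (y p - blinfun_apply p w0) * blinfun_apply p w)" for w
    by (simp add: G_def blinfun.sum_left blinfun.scaleR_left)
  have Gle: "G w \<le> G w0 + \<sigma>" if w: "norm w \<le> 1" for w
  proof -
    have "w0 + t *\<^sub>R (w - w0) = (1 - t) *\<^sub>R w0 + t *\<^sub>R w" by (simp add: algebra_simps)
    also have "norm \<dots> \<le> (1 - t) * norm w0 + t * norm w"
      using t by (intro order_trans[OF norm_triangle_ineq]) simp
    also have "\<dots> \<le> (1 - t) * 1 + t * 1" using w0(1) w t by (intro add_mono mult_left_mono) auto
    finally have "q w0 \<le> q (w0 + t *\<^sub>R (w - w0)) + \<sigma> * t" using min by simp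
    also have "q (w0 + t *\<^sub>R (w - w0)) = q w0 - 2 * t * G (w - w0) + t\<^sup>2 * (\<Sum>p\<in>P. (blinfun_apply p (w - w0))\<^sup>2)"
      unfolding q_def G by (rule sum_square_error_along_line)
    finally have "2 * t * G (w - w0) \<le> t\<^sup>2 * (\<Sum>p\<in>P. (blinfun_apply p (w - w0))\<^sup>2) + \<sigma> * t" by simp
    moreover have "(\<Sum>p\<in>P. (blinfun_apply p (w - w0))\<^sup>2) \<le> M"
      unfolding M_def
    proof (rule sum_mono)
      fix p :: "'a \<Rightarrow>\<^sub>L real"
      have "norm (w - w0) \<le> 2" using norm_triangle_ineq4[of w w0] w w0(1) by simp
      then have "norm p * norm (w - w0) \<le> norm p * 2" by (intro mult_left_mono) auto
      then have "\<bar>blinfun_apply p (w - w0)\<bar> \<le> \<bar>2 * norm p\<bar>" using norm_blinfun[of p "w - w0"] by simp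
      then show "(blinfun_apply p (w - w0))\<^sup>2 \<le> (2 * norm p)\<^sup>2" 
        by (simp only: abs_le_square_iff)
    qed
    then have "t\<^sup>2 * (\<Sum>p\<in>P. (blinfun_apply p (w - w0))\<^sup>2) \<le> t\<^sup>2 * M" by (rule mult_left_mono) simp
    ultimately have "t * (2 * G (w - w0)) \<le> t * (t * M + \<sigma>)"
      by (simp add: power2_eq_square algebra_simps)
    then have "2 * G (w - w0) \<le> t * M + \<sigma>" using t(1) by simp
    with tM show ?thesis by (simp add: blinfun.diff_right)
  qed
  have "norm G \<le> G w0 + \<sigma>"
  proof (rule ccontr)
    assume "\<not> ?thesis"
    moreover have "0 \<le> G w0 + \<sigma>" using Gle[of 0] by simp
    ultimately obtain v where "norm v \<le> 1" "G w0 + \<sigma> < G v"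
      using norm_blinfun_less_obtain[of "G w0 + \<sigma>" G] by (metis not_le)
    then show False using Gle[of v] by simp
  qed
  moreover have "y G \<le> norm G"
    using norm_blinfun[of y G] y mult_right_mono[of "norm y" 1 "norm G"] by simp
  moreover have "y G - G w0 = q w0"
  proof -
    have "y G = (\<Sum>p\<in>P. (y p - blinfun_apply p w0) * y p)"
      by (simp add: G_def blinfun.sum_right blinfun.scaleR_right)
    then show ?thesis unfolding G q_def
      by (simp only: sum_subtractf[symmetric]) (simp add: power2_eq_square algebra_simps)
  qed
  ultimately have q: "q w0 \<le> \<eta>\<^sup>2" by (simp add: \<sigma>_def)
  have "\<bar>p w0 - y p\<bar> \<le> \<eta>" if "p \<in> P" for p
  proof -
    have "(y p - blinfun_apply p w0)\<^sup>2 \<le> q w0"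
      unfolding q_def by (rule member_le_sum[OF that]) (use P in auto)
    then have "(y p - blinfun_apply p w0)\<^sup>2 \<le> \<eta>\<^sup>2" using q by simp
    then show ?thesis using \<eta> by (simp add: abs_le_square_iff[symmetric] abs_minus_commute)
  qed
  with w0(1) show ?thesis by blast
qed

definition eval_blinfun :: "'a::real_normed_vector \<Rightarrow> ('a \<Rightarrow>\<^sub>L real) \<Rightarrow>\<^sub>L real" where
  "eval_blinfun x = Blinfun (\<lambda>f. blinfun_apply f x)"

lemma eval_blinfun_apply [simp]: "blinfun_apply (eval_blinfun x) f = f x"
  unfolding eval_blinfun_def by (simp add: bounded_linear_Blinfun_apply blinfun.bounded_linear_left)

lemma norm_eval_blinfun: "norm (eval_blinfun x) \<le> norm x"
proof (rule norm_blinfun_bound)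
  show "norm (eval_blinfun x f) \<le> norm x * norm f" for f
    using norm_blinfun[of f x] by (simp add: mult.commute)
qed simp

lemma blinfun_sum_scaleR_right:
  "blinfun_apply f (\<Sum>D\<in>X. w D *\<^sub>R x D) = (\<Sum>D\<in>X. w D * (blinfun_apply f (x D) :: real))"
  by (simp add: blinfun.sum_right blinfun.scaleR_right)

text \<open>Abstracts the path metric of a rooted tree in which the edge leading to a node has the
  weight of that node as its length.\<close>

locale weighted_tree =
  fixes S :: "nat set set" and w :: "nat set \<Rightarrow> real" and d :: "nat set \<Rightarrow> nat set \<Rightarrow> real"
  assumes fin: "A \<in> S \<Longrightarrow> finite A"
    and init: "A \<in> S \<Longrightarrow> init_seg B A \<Longrightarrow> B \<in> S"
    and w_nonneg: "A \<in> S \<Longrightarrow> 0 \<le> w A"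
    and d_eq: "A \<in> S \<Longrightarrow> B \<in> S \<Longrightarrow> d A B =
      (\<Sum>D | init_seg D A \<and> \<not> init_seg D B. w D) + (\<Sum>D | init_seg D B \<and> \<not> init_seg D A. w D)"
begin

definition branch_sum :: "(nat set \<Rightarrow> 'a::real_vector) \<Rightarrow> nat set \<Rightarrow> 'a" where
  "branch_sum x A = (\<Sum>D | init_seg D A. w D *\<^sub>R x D)"

abbreviation diff_nodes :: "nat set \<Rightarrow> nat set \<Rightarrow> nat set set" where
  "diff_nodes A B \<equiv> {D. init_seg D A \<and> \<not> init_seg D B}"

lemma finite_init_segs: "A \<in> S \<Longrightarrow> finite {D. init_seg D A}"
  by (rule finite_subset[of _ "Pow A"]) (auto simp: init_seg_def fin)

lemma diff_nodes_in: "A \<in> S \<Longrightarrow> D \<in> diff_nodes A B \<Longrightarrow> D \<in> S \<and> D \<noteq> {} \<and> 0 \<le> w D"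
  using init w_nonneg by auto

lemma branch_sum_diff:
  assumes "A \<in> S" "B \<in> S"
  shows "branch_sum x A - branch_sum x B =
    (\<Sum>D\<in>diff_nodes A B. w D *\<^sub>R x D) - (\<Sum>D\<in>diff_nodes B A. w D *\<^sub>R x D)"
proof -
  have "branch_sum x A = (\<Sum>D | init_seg D A \<and> init_seg D B. w D *\<^sub>R x D) + (\<Sum>D\<in>diff_nodes A B. w D *\<^sub>R x D)"
    if "A \<in> S" for A B
    unfolding branch_sum_def using finite_init_segs[OF that]
    by (subst sum.union_disjoint[symmetric]) (auto intro!: sum.cong finite_subset[OF _ finite_init_segs[OF that]])
  from this[OF assms(1), of B] this[OF assms(2), of A] show ?thesis
    by (simp add: conj_commute)
qed

lemma branch_sum_upper:
  fixes x :: "nat set \<Rightarrow> 'a::real_normed_vector"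
  assumes x: "\<And>D. D \<in> S \<Longrightarrow> norm (x D) \<le> 1" and "A \<in> S" "B \<in> S"
  shows "dist (branch_sum x A) (branch_sum x B) \<le> d A B"
proof -
  have "norm (\<Sum>D\<in>diff_nodes A B. w D *\<^sub>R x D) \<le> (\<Sum>D\<in>diff_nodes A B. w D)" if "A \<in> S" for A B
  proof (rule sum_norm_le)
    fix D assume "D \<in> diff_nodes A B"
    then show "norm (w D *\<^sub>R x D) \<le> w D"
      using diff_nodes_in[OF that] x mult_left_le[of "norm (x D)" "w D"] by auto
  qed
  from add_mono[OF this[OF assms(2), of B] this[OF assms(3), of A]] show ?thesis
    unfolding dist_norm branch_sum_diff[OF assms(2,3)] d_eq[OF assms(2,3)]
    by (rule order_trans[OF norm_triangle_ineq4])
qed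

lemma bilipschitz_embeds_branch_sum:
  fixes x :: "nat set \<Rightarrow> 'a::real_normed_vector"
  assumes x: "\<And>D. D \<in> S \<Longrightarrow> norm (x D) \<le> 1" and c: "0 < c"
    and lower: "\<And>A B. A \<in> S \<Longrightarrow> B \<in> S \<Longrightarrow> c * d A B \<le> norm (branch_sum x A - branch_sum x B)"
  shows "bilipschitz_embeds S d TYPE('a)"
  unfolding bilipschitz_embeds_def
  using branch_sum_upper[OF x] lower c
  by (intro exI[of _ "branch_sum x"] exI[of _ c] conjI exI[of _ 1] c ballI) (auto simp: dist_norm)

text \<open>Every node on exactly one branch contributes at least 2c times its weight to the test by
  \<open>f A - f B\<close>: the sign of the difference matches the side on which the node lies. The
  norm of the test functional is at most 2, which leaves the constant c.\<close>

lemma bilipschitz_embeds_vectors: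
  fixes x :: "nat set \<Rightarrow> 'a::real_normed_vector" and f :: "nat set \<Rightarrow> 'a \<Rightarrow>\<^sub>L real"
  assumes c: "0 < c" and x: "\<And>D. D \<in> S \<Longrightarrow> norm (x D) \<le> 1" and f: "\<And>D. D \<in> S \<Longrightarrow> norm (f D) \<le> 1"
    and fx: "\<And>D E. D \<in> S \<Longrightarrow> E \<in> S \<Longrightarrow> E \<noteq> {} \<Longrightarrow>
      if init_seg E D then 3 * c \<le> f D (x E) else \<bar>f D (x E)\<bar> \<le> c"
  shows "bilipschitz_embeds S d TYPE('a)"
proof (rule bilipschitz_embeds_branch_sum[of x c])
  fix A B assume AB: "A \<in> S" "B \<in> S"
  have *: "2 * c * (\<Sum>D\<in>diff_nodes A B. w D) \<le> (f A - f B) (\<Sum>D\<in>diff_nodes A B. w D *\<^sub>R x D)"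
    if "A \<in> S" "B \<in> S" for A B
    unfolding blinfun_sum_scaleR_right sum_distrib_left
  proof (rule sum_mono)
    fix D assume "D \<in> diff_nodes A B"
    then have D: "D \<in> S" "D \<noteq> {}" "0 \<le> w D" "init_seg D A" "\<not> init_seg D B"
      using diff_nodes_in[OF that(1)] by auto
    have "2 * c \<le> (f A - f B) (x D)"
      using fx[OF that(1) D(1,2)] fx[OF that(2) D(1,2)] D(4,5) by (auto simp: blinfun.diff_left)
    from mult_right_mono[OF this D(3)] show "2 * c * w D \<le> w D * (f A - f B) (x D)"
      by (simp add: mult.commute)
  qed
  have "2 * c * d A B \<le> (f A - f B) (branch_sum x A - branch_sum x B)"
    using *[OF AB] *[OF AB(2,1)]
    by (simp add: branch_sum_diff[OF AB] d_eq[OF AB] blinfun.diff_right blinfun.diff_left algebra_simps)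
  also have "\<dots> \<le> norm (f A - f B) * norm (branch_sum x A - branch_sum x B)"
    using norm_blinfun[of "f A - f B" "branch_sum x A - branch_sum x B"] by simp
  also have "\<dots> \<le> 2 * norm (branch_sum x A - branch_sum x B)"
    using norm_triangle_ineq4[of "f A" "f B"] f[OF AB(1)] f[OF AB(2)] by (intro mult_right_mono) auto
  finally show "c * d A B \<le> norm (branch_sum x A - branch_sum x B)" by simp
qed (use x c in auto)

text \<open>The first node \<open>E\<close> of the branch of \<open>A\<close> off that of
  \<open>B\<close> precedes all later ones, so \<open>g E\<close> is at least 3c on all of them and
  at most c in modulus on the nodes of the other side.\<close>

lemma bilipschitz_embeds_summing:
  fixes v :: "nat set \<Rightarrow> 'a::real_normed_vector" and g :: "nat set \<Rightarrow> 'a \<Rightarrow>\<^sub>L real"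
  assumes c: "0 < c" and v: "\<And>D. D \<in> S \<Longrightarrow> norm (v D) \<le> 1" and g: "\<And>D. D \<in> S \<Longrightarrow> norm (g D) \<le> 1"
    and gv: "\<And>D E. D \<in> S \<Longrightarrow> E \<in> S \<Longrightarrow> E \<noteq> {} \<Longrightarrow>
      if init_seg E D then 3 * c \<le> g E (v D) else \<bar>g E (v D)\<bar> \<le> c"
  shows "bilipschitz_embeds S d TYPE('a)"
proof (rule bilipschitz_embeds_branch_sum[of v c])
  fix A B assume AB: "A \<in> S" "B \<in> S"
  have *: "3 * c * (\<Sum>D\<in>diff_nodes A B. w D) - c * (\<Sum>D\<in>diff_nodes B A. w D)
      \<le> norm (branch_sum v A - branch_sum v B)" if AB: "A \<in> S" "B \<in> S" for A B
  proof (cases "diff_nodes A B = {}")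
    case True
    have "0 \<le> (\<Sum>D\<in>diff_nodes B A. w D)" using diff_nodes_in[OF AB(2)] by (intro sum_nonneg) blast
    then have "0 \<le> c * (\<Sum>D\<in>diff_nodes B A. w D)" using c by simp
    then show ?thesis unfolding True by (simp add: order_trans[OF _ norm_ge_zero])
  next
    case False
    obtain E where E: "E \<in> diff_nodes A B" "\<And>D. D \<in> diff_nodes A B \<Longrightarrow> card E \<le> card D"
      using ex_has_least_nat[of "\<lambda>D. D \<in> diff_nodes A B" _ card] False by blast
    have ES: "E \<in> S" "E \<noteq> {}" using diff_nodes_in[OF AB(1) E(1)] by auto
    have first: "init_seg E D" if D: "D \<in> diff_nodes A B" for D
    proof -
      have "init_seg E D \<or> init_seg D E" using E(1) D init_seg_linear[of E A D] by auto
      moreover have "D = E" if "init_seg D E"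
        using card_seteq[OF fin[OF ES(1)] _ E(2)[OF D]] that by (simp add: init_seg_def)
      ultimately show ?thesis by auto
    qed
    have "3 * c * (\<Sum>D\<in>diff_nodes A B. w D) \<le> g E (\<Sum>D\<in>diff_nodes A B. w D *\<^sub>R v D)"
      unfolding blinfun_sum_scaleR_right sum_distrib_left
    proof (rule sum_mono)
      fix D assume D: "D \<in> diff_nodes A B"
      have "3 * c \<le> g E (v D)" using gv[of D E] diff_nodes_in[OF AB(1) D] ES first[OF D] by simp
      then show "3 * c * w D \<le> w D * g E (v D)"
        using mult_right_mono[of "3 * c" "g E (v D)" "w D"] diff_nodes_in[OF AB(1) D] by (simp add: mult.commute)
    qed
    moreover have "g E (\<Sum>D\<in>diff_nodes B A. w D *\<^sub>R v D) \<le> c * (\<Sum>D\<in>diff_nodes B A. w D)"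
      unfolding blinfun_sum_scaleR_right sum_distrib_left
    proof (rule sum_mono)
      fix D assume D: "D \<in> diff_nodes B A"
      then have "\<not> init_seg E D" using E(1) init_seg_trans[of E D B] by auto
      then have "g E (v D) \<le> c" using gv[of D E] diff_nodes_in[OF AB(2) D] ES by auto
      then show "w D * g E (v D) \<le> c * w D"
        using mult_right_mono[of "g E (v D)" c "w D"] diff_nodes_in[OF AB(2) D] by (simp add: mult.commute)
    qed
    moreover have "g E (branch_sum v A - branch_sum v B) \<le> norm (branch_sum v A - branch_sum v B)"
      using norm_blinfun[of "g E" "branch_sum v A - branch_sum v B"] g[OF ES(1)]
        mult_right_mono[of "norm (g E)" 1 "norm (branch_sum v A - branch_sum v B)"] by simp
    ultimately show ?thesis by (simp add: branch_sum_diff[OF AB] blinfun.diff_right)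
  qed
  \<comment> \<open>Adding the two one-sided estimates leaves \<open>(3 - 1) * c\<close> on each
    side; here the ratio must exceed 1.\<close>
  from *[OF AB] *[OF AB(2,1)] show "c * d A B \<le> norm (branch_sum v A - branch_sum v B)"
    by (simp add: d_eq[OF AB] norm_minus_commute algebra_simps)
qed (use v c in auto)

end

section \<open>Application to a space and its dual\<close>

lemma (in admissible) weighted_tree_schreier: "weighted_tree (schreier l a) (zeta l a) (schreier_dist l a)"
  by unfold_locales (auto simp: schreier_finite_pos schreier_dist_eq intro: schreier_init_seg zeta_nonneg)

lemma (in admissible) szlenk_tree_schreier:
  fixes H :: "('a::real_normed_vector \<Rightarrow>\<^sub>L real) set"
  assumes "top.Value (omega_pow a) < szlenk_index TYPE('a)"
    and "\<And>y P \<eta>. norm y \<le> 1 \<Longrightarrow> finite P \<Longrightarrow> 0 < \<eta> \<Longrightarrow> \<exists>h\<in>H. \<forall>p\<in>P. \<bar>blinfun_apply h p - blinfun_apply y p\<bar> \<le> \<eta>"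
  shows "\<exists>h z c. 0 < c \<and> (\<forall>A\<in>S a. h A \<in> H \<and> norm (z A) \<le> 1) \<and>
    (\<forall>D\<in>S a. \<forall>E\<in>S a. E \<noteq> {} \<longrightarrow> (if init_seg E D then 3 * c \<le> blinfun_apply (h D) (z E)
       else \<bar>blinfun_apply (h D) (z E)\<bar> \<le> c))"
proof -
  obtain \<epsilon> where "0 < \<epsilon>" "szlenk_derivative_iter \<epsilon> (cball 0 1 :: ('a \<Rightarrow>\<^sub>L real) set) (omega_pow a) \<noteq> {}"
    using szlenk_index_greater_imp[OF assms(1)] by blast
  from szlenk_tree[OF _ schreier_init_seg tree_rank_schreier this assms(2)]
  show ?thesis using schreier_finite_pos by simp
qed

context admissible
begin

text \<open>The same system serves twice: the vectors \<open>z\<close> are tested by the functionals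
  \<open>h\<close>, and the functionals \<open>h\<close> by evaluations at the vectors
  \<open>z\<close>.\<close>

lemma embeds_of_szlenk_index:
  assumes "top.Value (omega_pow a) < szlenk_index TYPE('a::real_normed_vector)"
  shows "bilipschitz_embeds (S a) (schreier_dist l a) TYPE('a)"
    "bilipschitz_embeds (S a) (schreier_dist l a) TYPE('a \<Rightarrow>\<^sub>L real)"
proof -
  interpret weighted_tree "S a" "zeta l a" "schreier_dist l a" by (rule weighted_tree_schreier)
  have "\<exists>h\<in>cball 0 1. \<forall>p\<in>P. \<bar>blinfun_apply h p - blinfun_apply y p\<bar> \<le> \<eta>"
    if "norm y \<le> 1" "finite P" "0 < \<eta>" for y :: "'a \<Rightarrow>\<^sub>L real" and P \<eta>
    by (rule bexI[of _ y]) (use that in auto)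
  from szlenk_tree_schreier[OF assms this]
  obtain h :: "nat set \<Rightarrow> 'a \<Rightarrow>\<^sub>L real" and z c where hz: "0 < c" "\<forall>A\<in>S a. h A \<in> cball 0 1 \<and> norm (z A) \<le> 1"
    "\<forall>D\<in>S a. \<forall>E\<in>S a. E \<noteq> {} \<longrightarrow> (if init_seg E D then 3 * c \<le> blinfun_apply (h D) (z E)
       else \<bar>blinfun_apply (h D) (z E)\<bar> \<le> c)" by blast
  show "bilipschitz_embeds (S a) (schreier_dist l a) TYPE('a)"
    by (rule bilipschitz_embeds_vectors[of c z h]) (use hz in auto)
  have "norm (eval_blinfun (z D)) \<le> 1" if "D \<in> S a" for D
    using norm_eval_blinfun[of "z D"] hz(2) that by force
  then show "bilipschitz_embeds (S a) (schreier_dist l a) TYPE('a \<Rightarrow>\<^sub>L real)"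
    by (intro bilipschitz_embeds_summing[of c h "\<lambda>E. eval_blinfun (z E)"]) (use hz in auto)
qed

text \<open>The tree lives over the dual, so the \<open>z E\<close> are functionals on the original
  space. Goldstine's approximation lets each \<open>h D\<close> be evaluation at some
  \<open>v D\<close>, whence \<open>z E (v D) = h D (z E)\<close> and the summing argument
  applies.\<close>

lemma embeds_of_szlenk_index_dual:
  assumes "top.Value (omega_pow a) < szlenk_index TYPE('a::real_normed_vector \<Rightarrow>\<^sub>L real)"
  shows "bilipschitz_embeds (S a) (schreier_dist l a) TYPE('a)"
proof -
  interpret weighted_tree "S a" "zeta l a" "schreier_dist l a" by (rule weighted_tree_schreier)
  have "\<exists>h\<in>eval_blinfun ` cball 0 1. \<forall>p\<in>P. \<bar>blinfun_apply h p - blinfun_apply y p\<bar> \<le> \<eta>"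
    if "norm y \<le> 1" "finite P" "0 < \<eta>" for y :: "('a \<Rightarrow>\<^sub>L real) \<Rightarrow>\<^sub>L real" and P \<eta>
    using bidual_ball_approximation[OF that] by auto
  from szlenk_tree_schreier[OF assms this]
  obtain h :: "nat set \<Rightarrow> ('a \<Rightarrow>\<^sub>L real) \<Rightarrow>\<^sub>L real" and z c
    where hz: "0 < c" "\<forall>A\<in>S a. h A \<in> eval_blinfun ` cball 0 1 \<and> norm (z A) \<le> 1"
    "\<forall>D\<in>S a. \<forall>E\<in>S a. E \<noteq> {} \<longrightarrow> (if init_seg E D then 3 * c \<le> blinfun_apply (h D) (z E)
       else \<bar>blinfun_apply (h D) (z E)\<bar> \<le> c)" by blast
  have "\<forall>A\<in>S a. \<exists>v. norm v \<le> 1 \<and> h A = eval_blinfun v"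
    using hz(2) by (metis imageE mem_cball_0)
  then obtain v where v: "\<And>A. A \<in> S a \<Longrightarrow> norm (v A) \<le> 1 \<and> h A = eval_blinfun (v A)" by metis
  show ?thesis
  proof (rule bilipschitz_embeds_summing[of c v z])
    fix D E assume "D \<in> S a" "E \<in> S a" "E \<noteq> {}"
    moreover from this have "z E (v D) = h D (z E)" using v by simp
    ultimately show "if init_seg E D then 3 * c \<le> z E (v D) else \<bar>z E (v D)\<bar> \<le> c"
      using hz(3) by simp
  qed (use hz(1,2) v in auto)
qed

end

theorem theoremB:
  fixes l :: "omega1 \<Rightarrow> nat \<Rightarrow> omega1" and \<alpha> :: omega1
  assumes "admissible_sequences l"
    and "separable_space (euclidean :: 'a::banach topology)"
    and "max (szlenk_index TYPE('a)) (szlenk_index TYPE('a \<Rightarrow>\<^sub>L real)) > top.Value (omega_pow \<alpha>)"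
  shows "bilipschitz_embeds (schreier l \<alpha>) (schreier_dist l \<alpha>) TYPE('a) \<and>
         bilipschitz_embeds (schreier l \<alpha>) (schreier_dist l \<alpha>) TYPE('a \<Rightarrow>\<^sub>L real)"
proof -
  interpret admissible l by unfold_locales (rule assms(1))
  from assms(3) consider "top.Value (omega_pow \<alpha>) < szlenk_index TYPE('a)"
    | "top.Value (omega_pow \<alpha>) < szlenk_index TYPE('a \<Rightarrow>\<^sub>L real)"
    by (auto simp: less_max_iff_disj)
  \<comment> \<open>When the dual has large index, it embeds the tree by the vector argument applied
    to the dual itself, and the original space is reached through evaluations.\<close>
  then show ?thesis
    using embeds_of_szlenk_index[where 'a='a] embeds_of_szlenk_index(1)[where 'a="'a \<Rightarrow>\<^sub>L real"]
      embeds_of_szlenk_index_dual[where 'a='a] by cases auto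
qed

end
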